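(* Let $E$ be a finite directed graph without sources and let $(G,E)$ be a self-similar groupoid action. Let $M$ be the associated Hilbert bimodule over $C^*(G)$ and let $(i_M,i_{C^*(G)})$ be the universal Toeplitz representation of $M$ in $\mathcal{T}(G,E)=\mathcal{T}(M)$. Define $u:G\to\mathcal{T}(M)$, $p:E^0\to\mathcal{T}(M)$ and $s:E^1\to\mathcal{T}(M)$ by $u_g=i_{C^*(G)}(i_g)$, $p_v=i_{C^*(G)}(i_v)$ and $s_e=i_M(e\otimes1)$. Then (1) $u$ is a unitary representation of $G$ with $u_v=p_v$ for $v\in E^0$; (2) $(p,s)$ is a Toeplitz-Cuntz-Krieger $E$-family in $\mathcal{T}(M)$, and $\sum_{v\in E^0}p_v$ is an identity for $\mathcal{T}(M)$; (3) for $g\in G$ and $e\in E^1$, $u_gs_e=s_{g\cdot e}u_{g|_e}$ if $d(g)=r(e)$, and $u_gs_e=0$ otherwise; (4) for $g\in G$ and $v\in E^0$, $u_gp_v=p_{g\cdot v}u_g$ if $d(g)=v$, and $u_gp_v=0$ otherwise. The $C^*$-algebra $\mathcal{T}(M)$ is generated by $\{u_g\}\cup\{p_v\}\cup\{s_e\}$, and $(\mathcal{T}(M),(u,p,s))$ is universal for families satisfying these relations: whenever $B$ is a $C^*$-algebra containing families $U=\{U_g\}_{g\in G}$, $P=\{P_v\}_{v\in E^0}$, $S=\{S_e\}_{e\in E^1}$ satisfying the analogues of (1)--(4), there is a homomorphism $\mathcal{T}(M)\to B$ with $u_g\mapsto U_g$, $p_v\mapsto P_v$, $s_e\mapsto 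S_e$.
   Context: Graphs: for a directed graph $E=(E^0,E^1,r,s)$, $E^k$ is the set of paths $\mu=\mu_1\cdots\mu_k$ with $s(\mu_i)=r(\mu_{i+1})$; $r(\mu)=r(\mu_1)$, $s(\mu)=s(\mu_k)$; vertices are paths of length $0$; $E^*=\bigsqcup_{k\ge0}E^k$; $vE^k=\{\mu\in E^k:r(\mu)=v\}$, $vE^*=\bigsqcup_kvE^k$. "Without sources" means $vE^1\ne\emptyset$ for all $v\in E^0$. A Toeplitz-Cuntz-Krieger $E$-family $(p,s)$ consists of mutually orthogonal projections $p_v$ and partial isometries $s_e$ with $s_e^*s_e=p_{s(e)}$ and $p_v\ge\sum_{e\in vE^1}s_es_e^*$ for all $v$. Groupoids and self-similar actions: a groupoid $G$ with unit space $G^0$ is a small category with inverses, with domain and codomain maps $d,c:G\to G^0$, product $gh$ defined when $d(g)=c(h)$; it is discrete and units are identified with identity morphisms. A partial isomorphism of $E^*$ is a bijection $g:vE^*\to wE^*$ that maps $vE^k$ bijectively onto $wE^k$ for all $k\ge0$ and satisfies $g(\mu e)\in g(\mu)E^1$ for $\mu e\in vE^*$, $e\in E^1$; under composition these form a groupoid $\mathrm{PIso}(E^* )$ with unit space $E^0$ ($d(g)=v$, $c(g)=w$). A self-similar groupoid action $(G,E)$ is a groupoid $G$ with unit space $E^0$ and an injective unit-preserving homomorphism $G\to\mathrm{PIso}(E^* )$, written $g\cdot\mu$, such that for all $g\in G$, $e\in d(g)E^1$ there is a (unique) element $g|_e\in G$ with $g\cdot(e\mu)=(g\cdot e)(g|_e\cdot\mu)$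 for all $\mu\in s(e)E^*$. Unitary representations: a unitary representation $U$ of $G$ in a $C^*$-algebra assigns to each $v\in G^0$ a projection $U_v$ and to each $g\in G$ a partial isometry $U_g$ with initial projection $U_{d(g)}$ and final projection $U_{c(g)}$, with $U_gU_h=U_{gh}$ if $d(g)=c(h)$ and $0$ otherwise. $C^*(G)$ is the full groupoid $C^*$-algebra and $g\mapsto i_g$ its canonical (universal) unitary representation; $C^*(G)$ has identity $1=\sum_{v\in E^0}i_v$. The bimodule $M$: the graph bimodule $X(E)$ is $C(E^1)$, as a Hilbert $C(E^0)$-bimodule with $(a\cdot x\cdot b)(e)=a(r(e))x(e)b(s(e))$ and $\langle x,y\rangle(v)=\sum_{s(e)=v}\overline{x(e)}y(e)$; for $e\in E^1$ write $e$ for the point mass at $e$. $C(E^0)$ embeds unitally in $C^*(G)$ by sending the point mass at $v$ to $i_v$. $M:=X(E)\otimes_{C(E^0)}C^*(G)$ is the right Hilbert $C^*(G)$-module with $\langle x\otimes a,y\otimes b\rangle=a^*\langle x,y\rangle b$. There is a unitary representation $W:G\to\mathcal{L}(M)$ with $W_g(e\otimes a)=(g\cdot e)\otimes i_{g|_e}a$ if $d(g)=r(e)$ and $0$ otherwise, and the left action of $C^*(G)$ on $M$ is the homomorphism $C^*(G)\to\mathcal{L}(M)$ with $i_g\mapsto W_g$. A Toeplitz representation of $M$ in a $C^*$-algebra $B$ is a pair $(\psi,\pi)$ of a linear map $\psi:M\to B$ and a homomorphism $\pi:C^*(G)\to B$ with $\psi(a\cdot m\cdot b)=\pi(a)\psi(m)\pi(b)$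 and $\psi(m)^*\psi(n)=\pi(\langle m,n\rangle)$. $\mathcal{T}(M)$ is the $C^*$-algebra generated by a universal Toeplitz representation $(i_M,i_{C^*(G)})$. *)

theory Defs
  imports "HOL-Analysis.Analysis" "Graph_Theory.Digraph"
begin

section \<open>$C^*$-algebras\<close>

class scaleC =
  fixes scaleC :: "complex \<Rightarrow> 'a \<Rightarrow> 'a" (infixr "*\<^sub>C" 75)

class complex_vector = scaleC + ab_group_add +
  assumes scaleC_add_right: "c *\<^sub>C (x + y) = c *\<^sub>C x + c *\<^sub>C y"
    and scaleC_add_left: "(b + c) *\<^sub>C x = b *\<^sub>C x + c *\<^sub>C x"
    and scaleC_scaleC: "b *\<^sub>C c *\<^sub>C x = (b * c) *\<^sub>C x"
    and scaleC_one: "1 *\<^sub>C x = x"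

global_interpretation cvec: vector_space "scaleC :: complex \<Rightarrow> 'a \<Rightarrow> 'a::complex_vector"
  by unfold_locales (simp_all add: scaleC_add_right scaleC_add_left scaleC_scaleC scaleC_one)

abbreviation cspan :: "'a::complex_vector set \<Rightarrow> 'a set" where
  "cspan \<equiv> module.span scaleC"

abbreviation csubspace :: "'a::complex_vector set \<Rightarrow> bool" where
  "csubspace \<equiv> module.subspace scaleC"

abbreviation clinear :: "('a::complex_vector \<Rightarrow> 'b::complex_vector) \<Rightarrow> bool" where
  "clinear \<equiv> Vector_Spaces.linear scaleC scaleC"

class complex_normed_vector = complex_vector + real_normed_vector +
  assumes scaleR_scaleC: "scaleR r x = complex_of_real r *\<^sub>C x"
    and norm_scaleC: "norm (c *\<^sub>C x) = cmod c * norm x"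

class cbanach = complex_normed_vector + banach

text \<open>Neither a unit nor nontriviality is required.\<close>

class cstar_algebra = cbanach + real_normed_algebra +
  fixes star :: "'a \<Rightarrow> 'a"
  assumes mult_scaleC_left: "(c *\<^sub>C x) * y = c *\<^sub>C (x * y)"
    and mult_scaleC_right: "x * (c *\<^sub>C y) = c *\<^sub>C (x * y)"
    and star_add: "star (x + y) = star x + star y"
    and star_scaleC: "star (c *\<^sub>C x) = cnj c *\<^sub>C star x"
    and star_mult: "star (x * y) = star y * star x"
    and star_star: "star (star x) = x"
    and cstar_identity: "norm (star x * x) = (norm x)\<^sup>2"

definition star_hom :: "('a::cstar_algebra \<Rightarrow> 'b::cstar_algebra) \<Rightarrow> bool" where
  "star_hom f \<longleftrightarrow> clinear f \<and> (\<forall>x y. f (x * y) = f x * f y) \<and> (\<forall>x. f (star x) = star (f x))"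

definition projection :: "'a::cstar_algebra \<Rightarrow> bool" where
  "projection p \<longleftrightarrow> p * p = p \<and> star p = p"

definition partial_isometry :: "'a::cstar_algebra \<Rightarrow> bool" where
  "partial_isometry s \<longleftrightarrow> s * star s * s = s"

definition positive :: "'a::cstar_algebra \<Rightarrow> bool" where
  "positive a \<longleftrightarrow> (\<exists>b. a = star b * b)"

definition cstar_le :: "'a::cstar_algebra \<Rightarrow> 'a \<Rightarrow> bool" where
  "cstar_le a b \<longleftrightarrow> positive (b - a)"

definition cstar_subalgebra :: "'a::cstar_algebra set \<Rightarrow> bool" where
  "cstar_subalgebra D \<longleftrightarrow> csubspace D \<and> closed D \<and>
     (\<forall>x\<in>D. \<forall>y\<in>D. x * y \<in> D) \<and> (\<forall>x\<in>D. star x \<in> D)"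

definition cstar_generated :: "'a::cstar_algebra set \<Rightarrow> 'a set" where
  "cstar_generated S = \<Inter>{D. cstar_subalgebra D \<and> S \<subseteq> D}"

section \<open>Groupoids and unitary representations\<close>

text \<open>\<open>gcomp G g h\<close> is \<open>gh\<close>, meaningful when \<open>gdom G g = gcod G h\<close>.
  The unit \<open>v\<close>, viewed as a morphism, is \<open>gid G v\<close>.\<close>

record ('v, 'g) groupoid =
  gobj :: "'v set"
  garr :: "'g set"
  gdom :: "'g \<Rightarrow> 'v"
  gcod :: "'g \<Rightarrow> 'v"
  gid :: "'v \<Rightarrow> 'g"
  gcomp :: "'g \<Rightarrow> 'g \<Rightarrow> 'g"

definition is_groupoid :: "('v, 'g) groupoid \<Rightarrow> bool" where
  "is_groupoid G \<longleftrightarrow>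
     (\<forall>g\<in>garr G. gdom G g \<in> gobj G \<and> gcod G g \<in> gobj G) \<and>
     (\<forall>v\<in>gobj G. gid G v \<in> garr G \<and> gdom G (gid G v) = v \<and> gcod G (gid G v) = v) \<and>
     (\<forall>g\<in>garr G. \<forall>h\<in>garr G. gdom G g = gcod G h \<longrightarrow>
        gcomp G g h \<in> garr G \<and> gdom G (gcomp G g h) = gdom G h \<and> gcod G (gcomp G g h) = gcod G g) \<and>
     (\<forall>g\<in>garr G. gcomp G g (gid G (gdom G g)) = g \<and> gcomp G (gid G (gcod G g)) g = g) \<and>
     (\<forall>g\<in>garr G. \<forall>h\<in>garr G. \<forall>k\<in>garr G. gdom G g = gcod G h \<and> gdom G h = gcod G k \<longrightarrow>
        gcomp G (gcomp G g h) k = gcomp G g (gcomp G h k)) \<and>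
     (\<forall>g\<in>garr G. \<exists>h\<in>garr G. gdom G h = gcod G g \<and> gcod G h = gdom G g \<and>
        gcomp G h g = gid G (gdom G g) \<and> gcomp G g h = gid G (gcod G g))"

text \<open>Homomorphisms of groupoids with the same unit space that preserve the units.\<close>

definition unit_preserving_hom ::
    "('v, 'g) groupoid \<Rightarrow> ('v, 'h) groupoid \<Rightarrow> ('g \<Rightarrow> 'h) \<Rightarrow> bool" where
  "unit_preserving_hom G H F \<longleftrightarrow> gobj G = gobj H \<and>
     (\<forall>g\<in>garr G. F g \<in> garr H \<and> gdom H (F g) = gdom G g \<and> gcod H (F g) = gcod G g) \<and>
     (\<forall>v\<in>gobj G. F (gid G v) = gid H v) \<and>
     (\<forall>g\<in>garr G. \<forall>h\<in>garr G. gdom G g = gcod G h \<longrightarrow> F (gcomp G g h) = gcomp H (F g) (F h))"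

definition unitary_rep :: "('v, 'g) groupoid \<Rightarrow> ('g \<Rightarrow> 'a::cstar_algebra) \<Rightarrow> bool" where
  "unitary_rep G U \<longleftrightarrow>
     (\<forall>v\<in>gobj G. projection (U (gid G v))) \<and>
     (\<forall>g\<in>garr G. partial_isometry (U g) \<and>
        star (U g) * U g = U (gid G (gdom G g)) \<and> U g * star (U g) = U (gid G (gcod G g))) \<and>
     (\<forall>g\<in>garr G. \<forall>h\<in>garr G.
        U g * U h = (if gdom G g = gcod G h then U (gcomp G g h) else 0))"

text \<open>\<open>i\<close> generates \<open>'a\<close> and is universal for unitary representations of \<open>G\<close>: the property that
  characterises $C^*(G)$ and its canonical representation. HOL cannot quantify over all types inside
  a formula, so the $C^*$-algebra \<open>'b\<close> in which the other representations take values is a parameter.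
  In a theorem it is a type variable and thus ranges over all $C^*$-algebras.\<close>

definition universal_unitary_rep ::
    "'b::cstar_algebra itself \<Rightarrow> ('v, 'g) groupoid \<Rightarrow> ('g \<Rightarrow> 'a::cstar_algebra) \<Rightarrow> bool" where
  "universal_unitary_rep _ G i \<longleftrightarrow> unitary_rep G i \<and> cstar_generated (i ` garr G) = UNIV \<and>
     (\<forall>U :: 'g \<Rightarrow> 'b. unitary_rep G U \<longrightarrow> (\<exists>\<pi> :: 'a \<Rightarrow> 'b. star_hom \<pi> \<and> (\<forall>g\<in>garr G. \<pi> (i g) = U g)))"

text \<open>The identity of $C^*(G)$.\<close>

definition groupoid_one :: "('v, 'g) groupoid \<Rightarrow> ('g \<Rightarrow> 'a::cstar_algebra) \<Rightarrow> 'a" where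
  "groupoid_one G i = (\<Sum>v\<in>gobj G. i (gid G v))"

section \<open>Graphs, paths and self-similar actions\<close>

text \<open>The source of \<open>e\<close> is \<open>tail E e\<close>, its range is \<open>head E e\<close>.\<close>

definition without_sources :: "('v, 'e) pre_digraph \<Rightarrow> bool" where
  "without_sources E \<longleftrightarrow> (\<forall>v\<in>verts E. \<exists>e\<in>arcs E. head E e = v)"

definition toeplitz_ck_family ::
    "('v, 'e) pre_digraph \<Rightarrow> ('v \<Rightarrow> 'a::cstar_algebra) \<Rightarrow> ('e \<Rightarrow> 'a) \<Rightarrow> bool" where
  "toeplitz_ck_family E p s \<longleftrightarrow>
     (\<forall>v\<in>verts E. projection (p v)) \<and>
     (\<forall>v\<in>verts E. \<forall>w\<in>verts E. v \<noteq> w \<longrightarrow> p v * p w = 0) \<and>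
     (\<forall>e\<in>arcs E. partial_isometry (s e) \<and> star (s e) * s e = p (tail E e)) \<and>
     (\<forall>v\<in>verts E. cstar_le (\<Sum>e\<in>{e\<in>arcs E. head E e = v}. s e * star (s e)) (p v))"

text \<open>A path is encoded as the pair of its range and its list of edges, so the vertex \<open>v\<close> is the
  path \<open>(v, [])\<close>. Consecutive edges satisfy $s(\mu_i) = r(\mu_{i+1})$.\<close>

type_synonym ('v, 'e) path = "'v \<times> 'e list"

fun edge_seq :: "('v, 'e) pre_digraph \<Rightarrow> 'v \<Rightarrow> 'e list \<Rightarrow> bool" where
  "edge_seq E v [] \<longleftrightarrow> v \<in> verts E"
| "edge_seq E v (e # es) \<longleftrightarrow> e \<in> arcs E \<and> head E e = v \<and> edge_seq E (tail E e) es"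

definition paths_len :: "('v, 'e) pre_digraph \<Rightarrow> 'v \<Rightarrow> nat \<Rightarrow> ('v, 'e) path set" where
  "paths_len E v k = {(v, es) | es. edge_seq E v es \<and> length es = k}"

definition paths :: "('v, 'e) pre_digraph \<Rightarrow> 'v \<Rightarrow> ('v, 'e) path set" where
  "paths E v = (\<Union>k. paths_len E v k)"

definition path_source :: "('v, 'e) pre_digraph \<Rightarrow> ('v, 'e) path \<Rightarrow> 'v" where
  "path_source E \<mu> = (if snd \<mu> = [] then fst \<mu> else tail E (last (snd \<mu>)))"

definition edge_path :: "('v, 'e) pre_digraph \<Rightarrow> 'e \<Rightarrow> ('v, 'e) path" where
  "edge_path E e = (head E e, [e])"

text \<open>Only meaningful when the source of \<open>\<mu>\<close> is the range of \<open>\<nu>\<close>.\<close>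

definition path_concat :: "('v, 'e) path \<Rightarrow> ('v, 'e) path \<Rightarrow> ('v, 'e) path" where
  "path_concat \<mu> \<nu> = (fst \<mu>, snd \<mu> @ snd \<nu>)"

text \<open>Being \<open>extensional\<close> makes equality of the HOL functions agree with equality of the maps
  on \<open>paths E v\<close>.\<close>

definition partial_iso ::
    "('v, 'e) pre_digraph \<Rightarrow> 'v \<Rightarrow> 'v \<Rightarrow> (('v, 'e) path \<Rightarrow> ('v, 'e) path) \<Rightarrow> bool" where
  "partial_iso E v w g \<longleftrightarrow> v \<in> verts E \<and> w \<in> verts E \<and> g \<in> extensional (paths E v) \<and>
     bij_betw g (paths E v) (paths E w) \<and>
     (\<forall>k. bij_betw g (paths_len E v k) (paths_len E w k)) \<and>
     (\<forall>\<mu>\<in>paths E v. \<forall>e\<in>arcs E. path_source E \<mu> = head E e \<longrightarrow>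
        (\<exists>f\<in>arcs E. path_source E (g \<mu>) = head E f \<and>
           g (path_concat \<mu> (edge_path E e)) = path_concat (g \<mu>) (edge_path E f)))"

definition PIso :: "('v, 'e) pre_digraph \<Rightarrow>
    ('v, 'v \<times> 'v \<times> (('v, 'e) path \<Rightarrow> ('v, 'e) path)) groupoid" where
  "PIso E = \<lparr>gobj = verts E,
     garr = {(v, w, g). partial_iso E v w g},
     gdom = (\<lambda>(v, w, g). v),
     gcod = (\<lambda>(v, w, g). w),
     gid = (\<lambda>v. (v, v, restrict id (paths E v))),
     gcomp = (\<lambda>(w', x, g) (v, w, h). (v, x, compose (paths E v) g h))\<rparr>"

type_synonym ('v, 'e, 'g) action = "'g \<Rightarrow> 'v \<times> 'v \<times> (('v, 'e) path \<Rightarrow> ('v, 'e) path)"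

definition act :: "('v, 'e, 'g) action \<Rightarrow> 'g \<Rightarrow> ('v, 'e) path \<Rightarrow> ('v, 'e) path" where
  "act \<Phi> g \<mu> = snd (snd (\<Phi> g)) \<mu>"

definition act_vertex :: "('v, 'e, 'g) action \<Rightarrow> 'g \<Rightarrow> 'v \<Rightarrow> 'v" where
  "act_vertex \<Phi> g v = fst (act \<Phi> g (v, []))"

definition act_edge :: "('v, 'e) pre_digraph \<Rightarrow> ('v, 'e, 'g) action \<Rightarrow> 'g \<Rightarrow> 'e \<Rightarrow> 'e" where
  "act_edge E \<Phi> g e = hd (snd (act \<Phi> g (edge_path E e)))"

definition is_restriction ::
    "('v, 'e) pre_digraph \<Rightarrow> ('v, 'g) groupoid \<Rightarrow> ('v, 'e, 'g) action \<Rightarrow> 'g \<Rightarrow> 'e \<Rightarrow> 'g \<Rightarrow> bool" where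
  "is_restriction E G \<Phi> g e h \<longleftrightarrow> h \<in> garr G \<and>
     gdom G h = tail E e \<and> gcod G h = tail E (act_edge E \<Phi> g e) \<and>
     (\<forall>\<mu>\<in>paths E (tail E e). act \<Phi> g (path_concat (edge_path E e) \<mu>) =
        path_concat (act \<Phi> g (edge_path E e)) (act \<Phi> h \<mu>))"

definition self_similar_action ::
    "('v, 'e) pre_digraph \<Rightarrow> ('v, 'g) groupoid \<Rightarrow> ('v, 'e, 'g) action \<Rightarrow> bool" where
  "self_similar_action E G \<Phi> \<longleftrightarrow> is_groupoid G \<and> gobj G = verts E \<and>
     unit_preserving_hom G (PIso E) \<Phi> \<and> inj_on \<Phi> (garr G) \<and>
     (\<forall>g\<in>garr G. \<forall>e\<in>arcs E. gdom G g = head E e \<longrightarrow> (\<exists>h. is_restriction E G \<Phi> g e h))"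

text \<open>The element $g|_e$, which is unique because \<open>\<Phi>\<close> is injective.\<close>

definition restriction ::
    "('v, 'e) pre_digraph \<Rightarrow> ('v, 'g) groupoid \<Rightarrow> ('v, 'e, 'g) action \<Rightarrow> 'g \<Rightarrow> 'e \<Rightarrow> 'g" where
  "restriction E G \<Phi> g e = (THE h. is_restriction E G \<Phi> g e h)"

section \<open>Hilbert modules and the bimodule $M$\<close>

text \<open>A right Hilbert \<open>'a\<close>-module structure on \<open>'m\<close>. Completeness in the norm
  $\|\langle x,x\rangle\|^{1/2}$ is part of the class \<open>cbanach\<close>, and the norm condition contains
  definiteness of the inner product.\<close>

locale hilbert_module =
  fixes ip :: "'m::cbanach \<Rightarrow> 'm \<Rightarrow> 'a::cstar_algebra"
    and ract :: "'m \<Rightarrow> 'a \<Rightarrow> 'm"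
  assumes ract_add_left: "ract (x + y) a = ract x a + ract y a"
    and ract_add_right: "ract x (a + b) = ract x a + ract x b"
    and ract_scaleC_left: "ract (c *\<^sub>C x) a = c *\<^sub>C ract x a"
    and ract_scaleC_right: "ract x (c *\<^sub>C a) = c *\<^sub>C ract x a"
    and ract_mult: "ract x (a * b) = ract (ract x a) b"
    and ip_add_right: "ip x (y + z) = ip x y + ip x z"
    and ip_scaleC_right: "ip x (c *\<^sub>C y) = c *\<^sub>C ip x y"
    and ip_ract_right: "ip x (ract y a) = ip x y * a"
    and ip_star: "star (ip x y) = ip y x"
    and ip_positive: "positive (ip x x)"
    and norm_ip: "norm x = sqrt (norm (ip x x))"

definition is_adjoint ::
    "('m \<Rightarrow> 'm \<Rightarrow> 'a::cstar_algebra) \<Rightarrow> ('m \<Rightarrow> 'm) \<Rightarrow> ('m \<Rightarrow> 'm) \<Rightarrow> bool" where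
  "is_adjoint ip S T \<longleftrightarrow> (\<forall>x y. ip (S x) y = ip x (T y))"

definition adjointable :: "('m \<Rightarrow> 'm \<Rightarrow> 'a::cstar_algebra) \<Rightarrow> ('m \<Rightarrow> 'm) \<Rightarrow> bool" where
  "adjointable ip S \<longleftrightarrow> (\<exists>T. is_adjoint ip S T)"

text \<open>A homomorphism of $*$-algebras from \<open>'a\<close> to the adjointable operators $\mathcal{L}(M)$.\<close>

definition left_action ::
    "('m::complex_vector \<Rightarrow> 'm \<Rightarrow> 'a::cstar_algebra) \<Rightarrow> ('a \<Rightarrow> 'm \<Rightarrow> 'm) \<Rightarrow> bool" where
  "left_action ip \<phi> \<longleftrightarrow>
     (\<forall>a. adjointable ip (\<phi> a)) \<and>
     (\<forall>a b x. \<phi> (a + b) x = \<phi> a x + \<phi> b x) \<and>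
     (\<forall>c a x. \<phi> (c *\<^sub>C a) x = c *\<^sub>C \<phi> a x) \<and>
     (\<forall>a b. \<phi> (a * b) = \<phi> a \<circ> \<phi> b) \<and>
     (\<forall>a. is_adjoint ip (\<phi> a) (\<phi> (star a)))"

text \<open>$C(E^0)$ and the graph bimodule $X(E) = C(E^1)$; functions are extended by zero.\<close>

definition vertex_functions :: "('v, 'e) pre_digraph \<Rightarrow> ('v \<Rightarrow> complex) set" where
  "vertex_functions E = {f. \<forall>v. v \<notin> verts E \<longrightarrow> f v = 0}"

definition edge_functions :: "('v, 'e) pre_digraph \<Rightarrow> ('e \<Rightarrow> complex) set" where
  "edge_functions E = {x. \<forall>e. e \<notin> arcs E \<longrightarrow> x e = 0}"

definition graph_ract ::
    "('v, 'e) pre_digraph \<Rightarrow> ('e \<Rightarrow> complex) \<Rightarrow> ('v \<Rightarrow> complex) \<Rightarrow> 'e \<Rightarrow> complex" where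
  "graph_ract E x b = (\<lambda>e. x e * b (tail E e))"

definition graph_ip ::
    "('v, 'e) pre_digraph \<Rightarrow> ('e \<Rightarrow> complex) \<Rightarrow> ('e \<Rightarrow> complex) \<Rightarrow> 'v \<Rightarrow> complex" where
  "graph_ip E x y = (\<lambda>v. \<Sum>e\<in>{e\<in>arcs E. tail E e = v}. cnj (x e) * y e)"

definition point_mass :: "'e \<Rightarrow> 'e \<Rightarrow> complex" where
  "point_mass e = (\<lambda>f. if f = e then 1 else 0)"

text \<open>The embedding of $C(E^0)$ in $C^*(G)$, where $E^0$ is the unit space of \<open>G\<close>.\<close>

definition vertex_embedding ::
    "('v, 'g) groupoid \<Rightarrow> ('g \<Rightarrow> 'a::cstar_algebra) \<Rightarrow> ('v \<Rightarrow> complex) \<Rightarrow> 'a" where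
  "vertex_embedding G i f = (\<Sum>v\<in>gobj G. f v *\<^sub>C i (gid G v))"

text \<open>\<open>tens x a\<close> is $x \otimes a$. The locale says that the Hilbert module \<open>'m\<close> is
  $X(E) \otimes_{C(E^0)} C^*(G)$, which is a completion of the algebraic balanced tensor product:
  the elementary tensors span a dense subspace.\<close>

locale graph_tensor_module = hilbert_module ip ract
  for E :: "('v, 'e) pre_digraph"
    and G :: "('v, 'g) groupoid"
    and i :: "'g \<Rightarrow> 'a::cstar_algebra"
    and ip :: "'m::cbanach \<Rightarrow> 'm \<Rightarrow> 'a"
    and ract :: "'m \<Rightarrow> 'a \<Rightarrow> 'm" +
  fixes tens :: "('e \<Rightarrow> complex) \<Rightarrow> 'a \<Rightarrow> 'm"
  assumes tens_add_left: "\<lbrakk>x \<in> edge_functions E; y \<in> edge_functions E\<rbrakk> \<Longrightarrow>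
        tens (\<lambda>e. x e + y e) a = tens x a + tens y a"
    and tens_scaleC_left: "x \<in> edge_functions E \<Longrightarrow> tens (\<lambda>e. c * x e) a = c *\<^sub>C tens x a"
    and tens_add_right: "x \<in> edge_functions E \<Longrightarrow> tens x (a + b) = tens x a + tens x b"
    and tens_scaleC_right: "x \<in> edge_functions E \<Longrightarrow> tens x (c *\<^sub>C a) = c *\<^sub>C tens x a"
    and tens_balanced: "\<lbrakk>x \<in> edge_functions E; f \<in> vertex_functions E\<rbrakk> \<Longrightarrow>
        tens (graph_ract E x f) a = tens x (vertex_embedding G i f * a)"
    and tens_ract: "x \<in> edge_functions E \<Longrightarrow> ract (tens x a) b = tens x (a * b)"
    and tens_ip: "\<lbrakk>x \<in> edge_functions E; y \<in> edge_functions E\<rbrakk> \<Longrightarrow>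
        ip (tens x a) (tens y b) = star a * vertex_embedding G i (graph_ip E x y) * b"
    and tens_dense: "closure (cspan {tens x a | x a. x \<in> edge_functions E}) = UNIV"

text \<open>The operators $W_g$. That \<open>W\<close> is a unitary representation follows from \<open>bimodule_action\<close>.\<close>

definition module_rep :: "('v, 'e) pre_digraph \<Rightarrow> ('v, 'g) groupoid \<Rightarrow> ('v, 'e, 'g) action \<Rightarrow>
    ('g \<Rightarrow> 'a::cstar_algebra) \<Rightarrow> ('m::cbanach \<Rightarrow> 'm \<Rightarrow> 'a) \<Rightarrow> (('e \<Rightarrow> complex) \<Rightarrow> 'a \<Rightarrow> 'm) \<Rightarrow>
    ('g \<Rightarrow> 'm \<Rightarrow> 'm) \<Rightarrow> bool" where
  "module_rep E G \<Phi> i ip tens W \<longleftrightarrow>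
     (\<forall>g\<in>garr G. adjointable ip (W g) \<and>
       (\<forall>e\<in>arcs E. \<forall>a. W g (tens (point_mass e) a) =
          (if gdom G g = head E e
           then tens (point_mass (act_edge E \<Phi> g e)) (i (restriction E G \<Phi> g e) * a)
           else 0)))"

definition bimodule_action :: "('v, 'e) pre_digraph \<Rightarrow> ('v, 'g) groupoid \<Rightarrow> ('v, 'e, 'g) action \<Rightarrow>
    ('g \<Rightarrow> 'a::cstar_algebra) \<Rightarrow> ('m::cbanach \<Rightarrow> 'm \<Rightarrow> 'a) \<Rightarrow> (('e \<Rightarrow> complex) \<Rightarrow> 'a \<Rightarrow> 'm) \<Rightarrow>
    ('a \<Rightarrow> 'm \<Rightarrow> 'm) \<Rightarrow> bool" where
  "bimodule_action E G \<Phi> i ip tens \<phi> \<longleftrightarrow> left_action ip \<phi> \<and>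
     (\<exists>W. module_rep E G \<Phi> i ip tens W \<and> (\<forall>g\<in>garr G. \<phi> (i g) = W g))"

section \<open>Toeplitz representations\<close>

definition toeplitz_rep :: "('m::cbanach \<Rightarrow> 'm \<Rightarrow> 'a::cstar_algebra) \<Rightarrow> ('m \<Rightarrow> 'a \<Rightarrow> 'm) \<Rightarrow>
    ('a \<Rightarrow> 'm \<Rightarrow> 'm) \<Rightarrow> ('m \<Rightarrow> 'b::cstar_algebra) \<Rightarrow> ('a \<Rightarrow> 'b) \<Rightarrow> bool" where
  "toeplitz_rep ip ract \<phi> \<psi> \<pi> \<longleftrightarrow> clinear \<psi> \<and> star_hom \<pi> \<and>
     (\<forall>a m b. \<psi> (ract (\<phi> a m) b) = \<pi> a * \<psi> m * \<pi> b) \<and>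
     (\<forall>m n. star (\<psi> m) * \<psi> n = \<pi> (ip m n))"

text \<open>\<open>(iM, iA)\<close> generates \<open>'t\<close> and is universal for Toeplitz representations: the property that
  characterises $\mathcal{T}(M)$. As for \<open>universal_unitary_rep\<close>, \<open>'b\<close> is the target of the other
  representations.\<close>

definition universal_toeplitz_rep :: "'b::cstar_algebra itself \<Rightarrow>
    ('m::cbanach \<Rightarrow> 'm \<Rightarrow> 'a::cstar_algebra) \<Rightarrow> ('m \<Rightarrow> 'a \<Rightarrow> 'm) \<Rightarrow> ('a \<Rightarrow> 'm \<Rightarrow> 'm) \<Rightarrow>
    ('m \<Rightarrow> 't::cstar_algebra) \<Rightarrow> ('a \<Rightarrow> 't) \<Rightarrow> bool" where
  "universal_toeplitz_rep _ ip ract \<phi> iM iA \<longleftrightarrow> toeplitz_rep ip ract \<phi> iM iA \<and>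
     cstar_generated (range iM \<union> range iA) = UNIV \<and>
     (\<forall>(\<psi> :: 'm \<Rightarrow> 'b) (\<pi> :: 'a \<Rightarrow> 'b). toeplitz_rep ip ract \<phi> \<psi> \<pi> \<longrightarrow>
        (\<exists>\<rho> :: 't \<Rightarrow> 'b. star_hom \<rho> \<and> (\<forall>m. \<rho> (iM m) = \<psi> m) \<and> (\<forall>a. \<rho> (iA a) = \<pi> a)))"

text \<open>The algebra \<open>'b\<close> need not be unital with identity $\sum_v P_v$.\<close>

definition self_similar_family ::
    "('v, 'e) pre_digraph \<Rightarrow> ('v, 'g) groupoid \<Rightarrow> ('v, 'e, 'g) action \<Rightarrow>
     ('g \<Rightarrow> 'b::cstar_algebra) \<Rightarrow> ('v \<Rightarrow> 'b) \<Rightarrow> ('e \<Rightarrow> 'b) \<Rightarrow> bool" where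
  "self_similar_family E G \<Phi> U P S \<longleftrightarrow>
     (unitary_rep G U \<and> (\<forall>v\<in>verts E. U (gid G v) = P v)) \<and>
     toeplitz_ck_family E P S \<and>
     (\<forall>g\<in>garr G. \<forall>e\<in>arcs E. U g * S e =
        (if gdom G g = head E e then S (act_edge E \<Phi> g e) * U (restriction E G \<Phi> g e) else 0)) \<and>
     (\<forall>g\<in>garr G. \<forall>v\<in>verts E. U g * P v =
        (if gdom G g = v then P (act_vertex \<Phi> g v) * U g else 0))"

end

(* The relations for (u, p, s) are computed in T(M). Conversely, a family (U, P, S) in B gives a
   homomorphism pi of C*(G), and since every m in M is the sum of the (e \<otimes> 1) \<langle>e \<otimes> 1, m\<rangle>, the only
   candidate for the linear map is psi m = \<Sum>e. S e * pi \<langle>e \<otimes> 1, m\<rangle>. That (psi, pi) is a Toeplitz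
   representation needs three facts about C*-algebras. Homomorphisms are bounded: a self-adjoint h of
   norm < 1 is the real part of h + \<i> sqrt (1 - h^2), which maps to a formal unitary. The inner product
   is bounded: polarize. And the inequality sum_e S_e S_e^* \<le> P_v forces the S_e to have orthogonal
   ranges: this rests on Kaplansky's theorem that -(y^* y) is positive only for y = 0. It is proved
   without spectral theory, positivity of h being replaced by the contractivity of exp (-t h) to first
   order in t. *)

theory Submission
  imports Defs
begin

text \<open>The algebras need not have a unit, so \<open>1 + c h\<close> is never an element: it is
  the operator \<open>z \<mapsto> z + c h z\<close>, on the algebra or on a Hilbert module, and
  every statement about it is an estimate on vectors \<open>z\<close>. The definition of
  \<open>positive\<close> supplies a single \<open>b\<close> with \<open>a = star b * b\<close>;
  that sums of such elements again have this form is not at hand. Accretivity avoids the question: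
  squares of self-adjoint elements are accretive, sums of accretive elements are accretive, and a
  self-adjoint \<open>h\<close> with both \<open>h\<close> and \<open>- h\<close> accretive is 0.
  Kaplansky's theorem is needed because cutting \<open>(\<Sum>e. q e) \<le> p\<close> down by one
  \<open>q f\<close> leaves \<open>0 \<le> - (q f (\<Sum>e\<noteq>f. q e) q f)\<close>. Boundedness
  is needed because \<open>M\<close> is given by a dense span and C*(G) by generators: the expansion
  of \<open>m\<close> is checked on elementary tensors, and
  \<open>\<psi> (\<phi> a m) = \<pi> a * \<psi> m\<close> on \<open>a = i g\<close>. Passing to
  closures requires continuity in \<open>m\<close> and in \<open>a\<close>.\<close>

section \<open>The involution and the norm\<close>

lemma star_zero [simp]: "star (0::'a::cstar_algebra) = 0"
  using star_add[of "0::'a" 0] by simp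

lemma star_minus [simp]: "star (- x) = - star (x::'a::cstar_algebra)"
  using star_add[of x "- x"] by (metis add.right_inverse add_eq_0_iff star_zero)

lemma star_diff: "star (x - y) = star x - star (y::'a::cstar_algebra)"
  using star_add[of x "- y"] by simp

lemma star_sum: "star (sum f A) = (\<Sum>x\<in>A. star (f x :: 'a::cstar_algebra))"
  by (induction A rule: infinite_finite_induct) (auto simp: star_add)

lemma star_scaleR: "star (r *\<^sub>R x) = r *\<^sub>R star (x::'a::cstar_algebra)"
  by (simp add: scaleR_scaleC star_scaleC)

lemma norm_star [simp]: "norm (star x) = norm (x::'a::cstar_algebra)"
proof -
  have le: "norm y \<le> norm (star y)" for y :: 'a
  proof (cases "y = 0")
    case False
    have "norm y * norm y \<le> norm (star y) * norm y"
      using norm_mult_ineq[of "star y" y] by (simp add: cstar_identity power2_eq_square)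
    with False show ?thesis by simp
  qed simp
  show ?thesis using le[of x] le[of "star x"] by (simp add: star_star)
qed

lemma star_mult_self_eq_0: "star x * x = 0 \<longleftrightarrow> x = (0::'a::cstar_algebra)"
  using cstar_identity[of x] by auto

lemma bounded_linear_star: "bounded_linear (star :: 'a::cstar_algebra \<Rightarrow> 'a)"
  by (rule bounded_linear_intro[where K = 1]) (simp_all add: star_add star_scaleR)

lemma continuous_on_star [continuous_intros]:
  "continuous_on A f \<Longrightarrow> continuous_on A (\<lambda>x. star (f x :: 'a::cstar_algebra))"
  by (rule bounded_linear.continuous_on[OF bounded_linear_star])

lemma norm_projection_mult_le:
  fixes q :: "'a::cstar_algebra"
  assumes "projection q" shows "norm (q * z) \<le> norm z"
proof (cases "norm (q * z) = 0")
  case False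
  have "(norm (q * z))\<^sup>2 = norm (star z * (q * z))"
    using assms by (simp add: cstar_identity[symmetric] star_mult projection_def mult.assoc)
      (metis mult.assoc)
  also have "\<dots> \<le> norm z * norm (q * z)"
    using norm_mult_ineq[of "star z" "q * z"] by simp
  finally show ?thesis using False by (simp add: power2_eq_square)
qed (metis norm_ge_zero)

section \<open>Accretive elements\<close>

text \<open>To first order in \<open>t\<close>, multiplication by \<open>1 - t h\<close> is a contraction. For self-adjoint \<open>h\<close>
  this is positivity, but expressed without a unit and without spectra, and it is obviously stable
  under sums.\<close>

definition accretive :: "'a::cstar_algebra \<Rightarrow> bool" where
  "accretive h \<longleftrightarrow> (\<exists>C\<ge>0. \<forall>t\<ge>0. \<forall>z. norm (z - t *\<^sub>R (h * z)) \<le> (1 + C * t\<^sup>2) * norm z)"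

lemma accretive_0: "accretive 0"
  unfolding accretive_def by (intro exI[of _ 0]) simp

text \<open>\<open>1 - t (g + h)\<close> is the average of \<open>1 - 2 t g\<close> and
  \<open>1 - 2 t h\<close>. The doubled parameter is squared in the error term, which turns
  \<open>C\<close> and \<open>D\<close> into \<open>2 C + 2 D\<close>.\<close>

lemma accretive_add:
  assumes "accretive g" "accretive h" shows "accretive (g + h)"
proof -
  obtain C where C: "C \<ge> 0" "\<And>t z. t \<ge> 0 \<Longrightarrow> norm (z - t *\<^sub>R (g * z)) \<le> (1 + C * t\<^sup>2) * norm z"
    using assms(1) unfolding accretive_def by blast
  obtain D where D: "D \<ge> 0" "\<And>t z. t \<ge> 0 \<Longrightarrow> norm (z - t *\<^sub>R (h * z)) \<le> (1 + D * t\<^sup>2) * norm z"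
    using assms(2) unfolding accretive_def by blast
  have "norm (z - t *\<^sub>R ((g + h) * z)) \<le> (1 + (2 * C + 2 * D) * t\<^sup>2) * norm z" if "t \<ge> 0" for t z
  proof -
    have "2 *\<^sub>R (z - t *\<^sub>R ((g + h) * z))
        = (z - (2 * t) *\<^sub>R (g * z)) + (z - (2 * t) *\<^sub>R (h * z))"
      by (simp add: algebra_simps scaleR_2)
    then have "2 * norm (z - t *\<^sub>R ((g + h) * z))
        \<le> norm (z - (2 * t) *\<^sub>R (g * z)) + norm (z - (2 * t) *\<^sub>R (h * z))"
      by (metis norm_triangle_ineq norm_scaleR abs_numeral)
    also have "\<dots> \<le> (1 + C * (2 * t)\<^sup>2) * norm z + (1 + D * (2 * t)\<^sup>2) * norm z"
      using C(2)[of "2 * t" z] D(2)[of "2 * t" z] that by (intro add_mono) auto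
    also have "\<dots> = 2 * ((1 + (2 * C + 2 * D) * t\<^sup>2) * norm z)"
      by (simp add: algebra_simps power2_eq_square)
    finally show ?thesis by simp
  qed
  then show ?thesis
    unfolding accretive_def using C(1) D(1) by (intro exI[of _ "2 * C + 2 * D"]) auto
qed

lemma accretive_sum: "(\<And>x. x \<in> A \<Longrightarrow> accretive (f x)) \<Longrightarrow> accretive (sum f A)"
  by (induction A rule: infinite_finite_induct) (auto intro: accretive_0 accretive_add)

lemma accretive_scaleR:
  assumes "accretive h" "r \<ge> 0" shows "accretive (r *\<^sub>R h)"
proof -
  obtain C where C: "C \<ge> 0" "\<And>t z. t \<ge> 0 \<Longrightarrow> norm (z - t *\<^sub>R (h * z)) \<le> (1 + C * t\<^sup>2) * norm z"
    using assms(1) unfolding accretive_def by blast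
  have "norm (z - t *\<^sub>R (r *\<^sub>R h * z)) \<le> (1 + (C * r\<^sup>2) * t\<^sup>2) * norm z" if "t \<ge> 0" for t z
    using C(2)[of "t * r" z] assms(2) that by (simp add: power_mult_distrib mult_ac)
  then show ?thesis
    unfolding accretive_def using C(1) by (intro exI[of _ "C * r\<^sup>2"]) auto
qed

text \<open>The elements \<open>(1 + c k) z\<close> and \<open>(1 - c k) z\<close> have the same norm and their average is \<open>z\<close>.\<close>

lemma norm_le_norm_add_imaginary:
  fixes k :: "'a::cstar_algebra"
  assumes k: "star k = k" and c: "cnj c = - c"
  shows "norm z \<le> norm (z + c *\<^sub>C (k * z))"
proof -
  define v where "v = z + c *\<^sub>C (k * z)"
  define w where "w = z - c *\<^sub>C (k * z)"
  have "star v * v = star w * w"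
    by (simp add: v_def w_def star_add star_diff star_scaleC star_mult k c algebra_simps
        mult_scaleC_left mult_scaleC_right cvec.scale_right_distrib cvec.scale_right_diff_distrib)
  then have "norm v = norm w"
    by (metis cstar_identity norm_ge_zero power2_eq_imp_eq)
  moreover have "2 *\<^sub>R z = v + w" by (simp add: v_def w_def scaleR_2)
  then have "2 * norm z \<le> norm v + norm w"
    by (metis norm_triangle_ineq norm_scaleR abs_numeral)
  ultimately show ?thesis by (simp add: v_def)
qed

text \<open>With \<open>c = \<i> sqrt t\<close> the operator \<open>1 + t k\<^sup>2\<close> factors
  as \<open>(1 - c k) (1 + c k)\<close>, and neither factor decreases norms.\<close>

lemma norm_le_norm_add_square:
  fixes k :: "'a::cstar_algebra"
  assumes "star k = k" "t \<ge> 0"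
  shows "norm z \<le> norm (z + t *\<^sub>R (k * k * z))"
proof -
  define c where "c = \<i> * complex_of_real (sqrt t)"
  have c: "cnj c = - c" "cnj (- c) = - (- c)" by (simp_all add: c_def)
  have cc: "c * c = - complex_of_real t"
    using assms(2) by (simp add: c_def algebra_simps flip: of_real_mult)
  define v where "v = z + c *\<^sub>C (k * z)"
  have "v + (- c) *\<^sub>C (k * v) = z - (c * c) *\<^sub>C (k * k * z)"
    by (simp add: v_def algebra_simps mult_scaleC_right cvec.scale_right_distrib)
  also have "\<dots> = z + t *\<^sub>R (k * k * z)" by (simp add: cc scaleR_scaleC)
  finally have "norm v \<le> norm (z + t *\<^sub>R (k * k * z))"
    using norm_le_norm_add_imaginary[OF assms(1) c(2), of v] by simp
  then show ?thesis
    using norm_le_norm_add_imaginary[OF assms(1) c(1), of z] by (simp add: v_def)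
qed

text \<open>The product of \<open>1 + t k\<^sup>2\<close> and \<open>1 - t k\<^sup>2\<close> is
  \<open>1 - t\<^sup>2 k\<^sup>4\<close>. The first factor does not decrease norms, so the second is
  contractive up to \<open>t\<^sup>2\<close> times the norm of \<open>k\<^sup>4\<close>.\<close>

lemma accretive_square:
  fixes k :: "'a::cstar_algebra"
  assumes "star k = k" shows "accretive (k * k)"
proof -
  have "norm (y - t *\<^sub>R (k * k * y)) \<le> (1 + norm (k * k * (k * k)) * t\<^sup>2) * norm y"
    if "t \<ge> 0" for t and y :: 'a
  proof -
    define z where "z = y - t *\<^sub>R (k * k * y)"
    have "z + t *\<^sub>R (k * k * z) = y - t\<^sup>2 *\<^sub>R (k * k * (k * k) * y)"
      by (simp add: z_def algebra_simps power2_eq_square)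
    then have "norm z \<le> norm (y - t\<^sup>2 *\<^sub>R (k * k * (k * k) * y))"
      using norm_le_norm_add_square[OF assms that, of z] by simp
    also have "\<dots> \<le> norm y + norm (t\<^sup>2 *\<^sub>R (k * k * (k * k) * y))" by (rule norm_triangle_ineq4)
    also have "\<dots> \<le> norm y + t\<^sup>2 * (norm (k * k * (k * k)) * norm y)"
      using norm_mult_ineq[of "k * k * (k * k)" y] by (simp add: mult_left_mono)
    finally show ?thesis by (simp add: z_def algebra_simps)
  qed
  then show ?thesis
    unfolding accretive_def by (intro exI[of _ "norm (k * k * (k * k))"]) auto
qed

lemma nonpos_if_le_all_multiples:
  fixes d K :: real
  assumes "\<And>t. 0 < t \<Longrightarrow> t \<le> 1 \<Longrightarrow> d \<le> t * K" shows "d \<le> 0"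
proof (rule ccontr)
  assume "\<not> d \<le> 0"
  then have d: "d > 0" by simp
  then have K: "K > 0" using assms[of 1] by simp
  define t where "t = min 1 (d / (2 * K))"
  have "t > 0" "t \<le> 1" using d K by (auto simp: t_def)
  then have "d \<le> t * K" by (rule assms)
  also have "\<dots> \<le> d / (2 * K) * K" using K by (intro mult_right_mono) (auto simp: t_def)
  finally show False using d K by simp
qed

text \<open>The function \<open>t \<mapsto> norm (z + t h z)\<close> is convex and, by accretivity, bounded below by its value
  at 0 up to \<open>O(t\<^sup>2)\<close>.\<close>

lemma accretive_norm_le:
  assumes "accretive h" shows "norm z \<le> norm (z + h * z)"
proof -
  obtain C where C: "C \<ge> 0" "\<And>t z. t \<ge> 0 \<Longrightarrow> norm (z - t *\<^sub>R (h * z)) \<le> (1 + C * t\<^sup>2) * norm z"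
    using assms unfolding accretive_def by blast
  define a where "a = norm z"
  define b where "b = norm (z + h * z)"
  define H where "H = norm (h * h)"
  have ab: "a \<ge> 0" "b \<ge> 0" "H \<ge> 0" by (simp_all add: a_def b_def H_def)
  have "a - b \<le> t * (H * a + C * (a + b))" if t: "0 < t" "t \<le> 1" for t
  proof -
    \<comment> \<open>\<open>v\<close> lies on the segment from \<open>z\<close> to
      \<open>z + h z\<close>, which bounds its norm above by \<open>(1 - t) a + t b\<close>.
      Applying \<open>1 - t h\<close> to \<open>v\<close> returns \<open>z\<close> up to
      \<open>t\<^sup>2 h\<^sup>2 z\<close>, which bounds it below. Division by \<open>t\<close>
      leaves an error of order \<open>t\<close>.\<close>
    define v where "v = z + t *\<^sub>R (h * z)"
    have "v = (1 - t) *\<^sub>R z + t *\<^sub>R (z + h * z)" by (simp add: v_def algebra_simps)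
    then have nv: "norm v \<le> (1 - t) * a + t * b"
      using norm_triangle_ineq[of "(1 - t) *\<^sub>R z" "t *\<^sub>R (z + h * z)"] t by (simp add: a_def b_def)
    have "z = (v - t *\<^sub>R (h * v)) + t\<^sup>2 *\<^sub>R (h * h * z)"
      by (simp add: v_def algebra_simps power2_eq_square)
    then have "a \<le> norm (v - t *\<^sub>R (h * v)) + norm (t\<^sup>2 *\<^sub>R (h * h * z))"
      unfolding a_def by (metis norm_triangle_ineq)
    moreover have "norm (t\<^sup>2 *\<^sub>R (h * h * z)) \<le> t\<^sup>2 * (H * a)"
      using norm_mult_ineq[of "h * h" z] by (simp add: H_def a_def mult_left_mono)
    ultimately have *: "a \<le> (1 + C * t\<^sup>2) * norm v + t\<^sup>2 * (H * a)"
      using C(2)[of t v] t by linarith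
    have "(1 + C * t\<^sup>2) * norm v \<le> (1 + C * t\<^sup>2) * ((1 - t) * a + t * b)"
      using nv C(1) by (intro mult_left_mono) auto
    with * have "a \<le> (1 + C * t\<^sup>2) * ((1 - t) * a + t * b) + t\<^sup>2 * (H * a)" by linarith
    then have "t * (a - b) \<le> t\<^sup>2 * (H * a) + C * t\<^sup>2 * ((1 - t) * a + t * b)"
      by (simp add: algebra_simps)
    also have "\<dots> \<le> t\<^sup>2 * (H * a) + C * t\<^sup>2 * (a + b)"
      using t ab C(1) by (intro add_left_mono mult_left_mono add_mono mult_left_le_one_le) auto
    also have "\<dots> = t * (t * (H * a + C * (a + b)))" by (simp add: algebra_simps power2_eq_square)
    finally show ?thesis using t by simp
  qed
  then have "a - b \<le> 0" by (rule nonpos_if_le_all_multiples)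
  then show ?thesis by (simp add: a_def b_def)
qed

section \<open>Antisymmetry of accretivity\<close>

fun double_power :: "'a::cstar_algebra \<Rightarrow> nat \<Rightarrow> 'a" where
  "double_power x 0 = x"
| "double_power x (Suc m) = 2 *\<^sub>R double_power x m + double_power x m * double_power x m"

text \<open>\<open>double_power x m\<close> is $(1+x)^{2^m} - 1$. For \<open>x = t h\<close> accretivity of \<open>h\<close> makes it at least as
  large as $2^m x$, and accretivity of \<open>-h\<close> keeps it bounded while $2^m t^2$ is.\<close>

lemma accretive_antisym:
  assumes h: "accretive h" and mh: "accretive (- h)" and sa: "star h = h"
  shows "h = 0"
proof -
  obtain C where C: "C \<ge> 0" "\<And>t z. t \<ge> 0 \<Longrightarrow> norm (z - t *\<^sub>R (- h * z)) \<le> (1 + C * t\<^sup>2) * norm z"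
    using mh unfolding accretive_def by blast
  have sa_f: "star (double_power (t *\<^sub>R h) m) = double_power (t *\<^sub>R h) m" for t m
    by (induction m) (simp_all add: star_scaleR sa star_add star_mult)
  \<comment> \<open>The recursion only adds twice an element to its square, and these operations
    keep self-adjoint accretive elements self-adjoint and accretive.\<close>
  have acc_f: "accretive (double_power (t *\<^sub>R h) m)" if "t \<ge> 0" for t m
    by (induction m)
      (auto intro!: accretive_add accretive_scaleR accretive_square sa_f h that)
  \<comment> \<open>If \<open>f\<close> is the current iterate, the next one is
    \<open>2 (1 + f/2) f\<close>. Since \<open>f/2\<close> is accretive, \<open>1 + f/2\<close> does
    not decrease norms, and each step at least doubles.\<close>
  have lower: "2 ^ m * norm (t *\<^sub>R h * z) \<le> norm (double_power (t *\<^sub>R h) m * z)" if "t \<ge> 0" for t m z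
  proof (induction m)
    case (Suc m)
    define w where "w = double_power (t *\<^sub>R h) m * z"
    have "2 * norm w \<le> 2 * norm (w + (1/2) *\<^sub>R double_power (t *\<^sub>R h) m * w)"
      using accretive_norm_le[OF accretive_scaleR[OF acc_f[OF that, of m], of "1/2"], of w] by simp
    also have "\<dots> = norm (2 *\<^sub>R (w + (1/2) *\<^sub>R double_power (t *\<^sub>R h) m * w))" by simp
    also have "2 *\<^sub>R (w + (1/2) *\<^sub>R double_power (t *\<^sub>R h) m * w) = double_power (t *\<^sub>R h) (Suc m) * z"
      by (simp add: w_def algebra_simps)
    finally show ?case using Suc by (simp add: w_def)
  qed simp
  have upper: "norm (z + double_power (t *\<^sub>R h) m * z) \<le> (1 + C * t\<^sup>2) ^ (2 ^ m) * norm z"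
    if "t \<ge> 0" for t m z
  proof (induction m arbitrary: z)
    case 0
    then show ?case using C(2)[OF that, of z] by simp
  next
    case (Suc m)
    define w where "w = z + double_power (t *\<^sub>R h) m * z"
    have "z + double_power (t *\<^sub>R h) (Suc m) * z = w + double_power (t *\<^sub>R h) m * w"
      by (simp add: w_def algebra_simps scaleR_2)
    then have "norm (z + double_power (t *\<^sub>R h) (Suc m) * z) \<le> (1 + C * t\<^sup>2) ^ (2 ^ m) * norm w"
      using Suc[of w] by simp
    also have "\<dots> \<le> (1 + C * t\<^sup>2) ^ (2 ^ m) * ((1 + C * t\<^sup>2) ^ (2 ^ m) * norm z)"
      using Suc[of z] C(1) by (intro mult_left_mono) (auto simp: w_def)
    also have "\<dots> = (1 + C * t\<^sup>2) ^ (2 ^ Suc m) * norm z" by (simp add: power_add mult_2)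
    finally show ?case .
  qed
  have bound: "2 ^ j * norm (h * h) \<le> (exp C + 1) * norm h" for j :: nat
  proof -
    \<comment> \<open>With \<open>2 * j\<close> doublings the lower bound carries the factor
      \<open>4 ^ j * t = 2 ^ j\<close>, whereas \<open>4 ^ j * t\<^sup>2 = 1\<close> keeps the
      factor of the upper bound below \<open>exp C\<close>.\<close>
    define t :: real where "t = 1 / 2 ^ j"
    have t: "t \<ge> 0" by (simp add: t_def)
    have t2: "t\<^sup>2 = 1 / 4 ^ j" 
      by (simp add: t_def power2_eq_square flip: power_mult_distrib)
    have "2 ^ j * norm (h * h) = 2 ^ (2 * j) * norm (t *\<^sub>R h * h)"
      by (simp add: t_def power_mult field_simps power2_eq_square flip: power_mult_distrib)
    also have "\<dots> \<le> norm (double_power (t *\<^sub>R h) (2 * j) * h)" by (rule lower[OF t])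
    also have "\<dots> \<le> norm (h + double_power (t *\<^sub>R h) (2 * j) * h) + norm h"
      by (metis add_diff_cancel_left' norm_triangle_ineq4 add.commute)
    also have "\<dots> \<le> (1 + C * t\<^sup>2) ^ (2 ^ (2 * j)) * norm h + norm h"
      using upper[OF t, of h "2 * j"] by simp
    also have "(1 + C * t\<^sup>2) ^ (2 ^ (2 * j)) = (1 + C / real (4 ^ j)) ^ (4 ^ j)"
      by (simp add: t2 power_mult)
    also have "(1 + C / real (4 ^ j)) ^ (4 ^ j) * norm h \<le> exp C * norm h"
      using C(1) by (intro mult_right_mono exp_ge_one_plus_x_over_n_power_n)
        (auto intro: order_trans[of _ 0])
    finally show ?thesis by (simp add: algebra_simps)
  qed
  have "norm (h * h) = 0"
  proof (rule ccontr)
    assume "norm (h * h) \<noteq> 0"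
    then obtain j :: nat where "(exp C + 1) * norm h / norm (h * h) < 2 ^ j"
      using real_arch_pow[of 2] by auto
    with bound[of j] \<open>norm (h * h) \<noteq> 0\<close> show False by (simp add: field_simps)
  qed
  then show ?thesis using star_mult_self_eq_0[of h] by (simp add: sa)
qed

section \<open>Growth of powers and Kaplansky's theorem\<close>

text \<open>Bernoulli's inequality alone is linear in the exponent. Squaring it, at the exponent
  \<open>2 ^ Suc m\<close>, gives a quadratic lower bound for \<open>r > 1\<close>, which no linear
  bound can follow.\<close>

lemma le_1_if_power_le_linear:
  fixes r A :: real
  assumes "\<And>m. r ^ (2 ^ m) \<le> 1 + A * 2 ^ m" shows "r \<le> 1"
proof (rule ccontr)
  assume "\<not> r \<le> 1"
  define d where "d = r - 1"
  have d: "d > 0" using \<open>\<not> r \<le> 1\<close> by (simp add: d_def)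
  obtain m :: nat where m: "2 * (\<bar>A\<bar> + 1) / d\<^sup>2 < 2 ^ m"
    using real_arch_pow[of 2] by auto
  define n :: real where "n = 2 ^ m"
  have n: "n \<ge> 1" by (simp add: n_def)
  have "1 + n * d \<le> r ^ (2 ^ m)"
    using Bernoulli_inequality[of d "2 ^ m"] d by (simp add: n_def d_def)
  then have "(1 + n * d)\<^sup>2 \<le> r ^ (2 ^ Suc m)"
    using n d by (subst power_Suc2, subst power_mult) (intro power_mono, auto)
  also have "\<dots> \<le> 1 + A * (2 * n)" using assms[of "Suc m"] by (simp add: n_def)
  finally have "(1 + n * d)\<^sup>2 \<le> 1 + n * (2 * A)" by (simp add: mult_ac)
  moreover have "(1 + n * d)\<^sup>2 = 1 + 2 * (n * d) + n * (n * d\<^sup>2)"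
    by (simp add: power2_eq_square algebra_simps)
  moreover have "n * d \<ge> 0" using n d by simp
  ultimately have "n * (n * d\<^sup>2) \<le> n * (2 * A)" by linarith
  then have "n * d\<^sup>2 \<le> 2 * A" using n by simp
  moreover have "2 * (\<bar>A\<bar> + 1) < n * d\<^sup>2" using m d by (simp add: n_def field_simps)
  moreover have "2 * A \<le> 2 * (\<bar>A\<bar> + 1)" by simp
  ultimately show False by linarith
qed

text \<open>For the formally self-adjoint \<open>B = 1 + k\<close> the C*-identity gives
  \<open>norm (B z)\<^sup>2 \<le> norm z * norm (B (B z))\<close>; this is iterated along the powers
  \<open>B ^^ (2 ^ m)\<close>. The growth of the orbit of one vector thus controls a single step, in
  place of a spectral radius formula.\<close>

lemma norm_power_le_selfadjoint:
  fixes k :: "'a::cstar_algebra"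
  assumes sa: "star k = k" and B: "B = (\<lambda>z. z + k * z)"
  shows "norm (B z) ^ (2 ^ m) \<le> norm z ^ (2 ^ m - 1) * norm ((B ^^ (2 ^ m)) z)"
proof -
  have step: "(norm (B z))\<^sup>2 \<le> norm z * norm (B (B z))" if sa: "star k = k" and B: "B = (\<lambda>z. z + k * z)"
    for z k :: 'a and B
  proof -
    have "star (B z) * B z = star z * B (B z)"
      by (simp add: B star_add star_mult sa algebra_simps)
    then show ?thesis
      by (metis cstar_identity norm_mult_ineq norm_star)
  qed
  have ex: "\<exists>l. star l = l \<and> B ^^ (2 ^ m) = (\<lambda>z. z + l * z)" for m
  proof (induction m)
    case 0
    show ?case using sa B by (intro exI[of _ k]) simp
  next
    case (Suc m)
    then obtain l where "star l = l" "B ^^ (2 ^ m) = (\<lambda>z. z + l * z)" by blast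
    \<comment> \<open>The square of \<open>1 + l\<close> is \<open>1 + (2 l + l\<^sup>2)\<close>,
      again formally self-adjoint.\<close>
    then show ?case
      by (intro exI[of _ "l + l + l * l"])
        (simp add: star_add star_mult funpow_add mult_2 fun_eq_iff algebra_simps)
  qed
  show ?thesis
  proof (induction m)
    case (Suc m)
    obtain l where l: "star l = l" "B ^^ (2 ^ m) = (\<lambda>z. z + l * z)" using ex by blast
    have "norm (B z) ^ (2 ^ Suc m) = (norm (B z) ^ (2 ^ m))\<^sup>2" by (metis power_Suc2 power_mult)
    also have "\<dots> \<le> (norm z ^ (2 ^ m - 1) * norm ((B ^^ (2 ^ m)) z))\<^sup>2"
      by (intro power_mono Suc) simp
    also have "\<dots> \<le> (norm z ^ (2 ^ m - 1))\<^sup>2 * (norm z * norm ((B ^^ (2 ^ m)) ((B ^^ (2 ^ m)) z)))"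
      using step[OF l] by (simp add: power_mult_distrib mult_left_mono)
    also have "\<dots> = norm z ^ (2 * (2 ^ m - 1) + 1) * norm ((B ^^ (2 ^ Suc m)) z)"
      by (simp add: power_mult[symmetric] mult.commute funpow_add mult_2 power_add)
    also have "2 * (2 ^ m - 1) + 1 = (2 ^ Suc m - 1 :: nat)"
      using one_le_power[of "2::nat" m] unfolding power_Suc by linarith
    finally show ?case .
  qed simp
qed

text \<open>The growth bound is demanded only on the range of \<open>k\<close>, which is where
  Kaplansky's argument can supply it. It extends to all vectors at the price of a factor linear in
  \<open>n\<close>, and log-convexity of the orbit norms removes such a factor.\<close>

lemma accretive_uminusI:
  fixes k :: "'a::cstar_algebra"
  assumes sa: "star k = k" and "C \<ge> 0" "M \<ge> 0"
    and bd: "\<And>t n z. t \<ge> 0 \<Longrightarrow>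
      norm (((\<lambda>w. w + t *\<^sub>R (k * w)) ^^ n) (k * z)) \<le> M * (1 + C * t\<^sup>2) ^ n * norm z"
  shows "accretive (- k)"
proof -
  have "norm (z + t *\<^sub>R (k * z)) \<le> (1 + C * t\<^sup>2) * norm z" if t: "t \<ge> 0" for t z
  proof (cases "z = 0")
    case False
    define B where "B = (\<lambda>w. w + t *\<^sub>R (k * w))"
    define c where "c = 1 + C * t\<^sup>2"
    have c: "c \<ge> 1" using \<open>C \<ge> 0\<close> by (simp add: c_def)
    have B_add: "(B ^^ n) (x + y) = (B ^^ n) x + (B ^^ n) y" for n x y
      by (induction n) (simp_all add: B_def algebra_simps)
    have B_scale: "(B ^^ n) (r *\<^sub>R x) = r *\<^sub>R (B ^^ n) x" for n x r
      by (induction n) (simp_all add: B_def algebra_simps)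
    \<comment> \<open>\<open>B ^^ n\<close> applied to \<open>z\<close> telescopes to
      \<open>z\<close> plus \<open>t\<close> times the sum of the vectors
      \<open>(B ^^ j) (k * z)\<close> with \<open>j < n\<close>, and \<open>bd\<close> bounds each
      summand.\<close>
    have grow: "norm ((B ^^ n) z) \<le> (1 + t * M * n) * c ^ n * norm z" for n
    proof (induction n)
      case (Suc n)
      have "(B ^^ Suc n) z = (B ^^ n) (B z)" by (simp add: funpow_swap1)
      also have "\<dots> = (B ^^ n) z + t *\<^sub>R (B ^^ n) (k * z)"
        by (subst (2) B_def) (simp add: B_add B_scale)
      finally have "norm ((B ^^ Suc n) z) \<le> norm ((B ^^ n) z) + t * norm ((B ^^ n) (k * z))"
        using t by (metis norm_triangle_ineq norm_scaleR abs_of_nonneg)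
      also have "\<dots> \<le> (1 + t * M * n) * c ^ n * norm z + t * (M * c ^ n * norm z)"
        using Suc bd[OF t, of n z] t by (intro add_mono mult_left_mono) (auto simp: B_def c_def)
      also have "\<dots> = (1 + t * M * Suc n) * (c ^ n * norm z)" by (simp add: algebra_simps)
      also have "\<dots> \<le> (1 + t * M * Suc n) * (c ^ Suc n * norm z)"
        using c t \<open>M \<ge> 0\<close> by (intro mult_left_mono mult_right_mono power_increasing) auto
      finally show ?case by (simp add: mult.assoc)
    qed simp
    have "(norm (B z) / (c * norm z)) ^ (2 ^ m) \<le> 1 + (t * M) * 2 ^ m" for m
    proof -
      have "norm (B z) ^ (2 ^ m) \<le> norm z ^ (2 ^ m - 1) * norm ((B ^^ (2 ^ m)) z)"
        using norm_power_le_selfadjoint[of "t *\<^sub>R k" B z m] by (simp add: B_def star_scaleR sa)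
      also have "\<dots> \<le> norm z ^ (2 ^ m - 1) * ((1 + t * M * 2 ^ m) * c ^ (2 ^ m) * norm z)"
        using grow[of "2 ^ m"] by (intro mult_left_mono) auto
      also have "\<dots> = (1 + t * M * 2 ^ m) * c ^ (2 ^ m) * (norm z ^ (2 ^ m - 1) * norm z)"
        by (simp add: mult_ac)
      also have "norm z ^ (2 ^ m - 1) * norm z = norm z ^ (2 ^ m)"
        by (metis power_minus_mult zero_less_numeral zero_less_power)
      finally show ?thesis
        using c False by (simp add: power_divide power_mult_distrib field_simps)
    qed
    then have "norm (B z) / (c * norm z) \<le> 1" by (rule le_1_if_power_le_linear)
    then have "norm (B z) \<le> c * norm z" using c False by (simp add: divide_le_eq)
    then show ?thesis by (simp add: B_def c_def)
  qed simp
  then show ?thesis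
    unfolding accretive_def using \<open>C \<ge> 0\<close> by (intro exI[of _ C]) auto
qed

text \<open>Kaplansky's argument: both \<open>-(star y * y)\<close> and \<open>-(y * star y)\<close> turn out to be accretive, while
  \<open>star y * y + y * star y\<close> is a sum of two squares.\<close>

lemma eq_0_if_star_mult_self_eq_minus_accretive:
  fixes y q d :: "'a::cstar_algebra"
  assumes q: "projection q" and yq: "y * q = y"
    and y: "star y * y = - (q * d * q)" and d: "accretive d"
  shows "y = 0"
proof -
  obtain C where C: "C \<ge> 0" "\<And>t z. t \<ge> 0 \<Longrightarrow> norm (z - t *\<^sub>R (d * z)) \<le> (1 + C * t\<^sup>2) * norm z"
    using d unfolding accretive_def by blast
  define a where "a = star y * y"
  define k where "k = y * star y"
  have sa: "star a = a" "star k = k" by (simp_all add: a_def k_def star_mult star_star)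
  have qq: "q * q = q" and sq: "star q = q" using q by (simp_all add: projection_def)
  have qy: "q * star y = star y" using yq by (metis sq star_mult)
  define B where "B t = (\<lambda>w. w + t *\<^sub>R (a * w))" for t
  \<comment> \<open>On the range of \<open>q\<close> the element \<open>a\<close> acts as
    \<open>- q d\<close>, so \<open>1 + t a\<close> is there the compression of
    \<open>1 - t d\<close> and inherits its bound. The range is invariant, so powers inherit the
    bound as well.\<close>
  have B: "q * B t w = B t w \<and> norm (B t w) \<le> (1 + C * t\<^sup>2) * norm w"
    if "t \<ge> 0" "q * w = w" for t w
  proof -
    have "B t w = w - t *\<^sub>R (q * d * (q * w))" by (simp add: B_def a_def y mult.assoc)
    also have "\<dots> = q * (w - t *\<^sub>R (d * w))" using that by (simp add: algebra_simps)
    finally have *: "B t w = q * (w - t *\<^sub>R (d * w))" .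
    show ?thesis
      using norm_projection_mult_le[OF q, of "w - t *\<^sub>R (d * w)"] C(2)[OF that(1), of w]
      unfolding * by (simp add: qq flip: mult.assoc)
  qed
  have Bn: "q * (B t ^^ n) w = (B t ^^ n) w \<and> norm ((B t ^^ n) w) \<le> (1 + C * t\<^sup>2) ^ n * norm w"
    if "t \<ge> 0" "q * w = w" for t w n
  proof (induction n)
    case (Suc n)
    have "norm ((B t ^^ Suc n) w) \<le> (1 + C * t\<^sup>2) * norm ((B t ^^ n) w)"
      using B[OF that(1), of "(B t ^^ n) w"] Suc by simp
    also have "\<dots> \<le> (1 + C * t\<^sup>2) * ((1 + C * t\<^sup>2) ^ n * norm w)"
      using Suc C(1) by (intro mult_left_mono) auto
    finally show ?case using B[OF that(1), of "(B t ^^ n) w"] Suc by simp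
  qed (use that in simp)
  have ma: "accretive (- a)"
  proof (rule accretive_uminusI[OF sa(1) C(1) norm_ge_zero])
    fix t :: real and n and z :: 'a assume t: "t \<ge> 0"
    have "norm ((B t ^^ n) (a * z)) \<le> (1 + C * t\<^sup>2) ^ n * norm (a * z)"
      using Bn[OF t, of "a * z" n] by (simp add: a_def qy flip: mult.assoc)
    also have "\<dots> \<le> (1 + C * t\<^sup>2) ^ n * (norm a * norm z)"
      using C(1) by (intro mult_left_mono norm_mult_ineq) auto
    finally show "norm (((\<lambda>w. w + t *\<^sub>R (a * w)) ^^ n) (a * z)) \<le> norm a * (1 + C * t\<^sup>2) ^ n * norm z"
      by (simp add: B_def mult_ac)
  qed
  have mk: "accretive (- k)"
  proof (rule accretive_uminusI[OF sa(2) C(1), of "norm y * norm y"])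
    fix t :: real and n and z :: 'a assume t: "t \<ge> 0"
    \<comment> \<open>\<open>y\<close> intertwines \<open>1 + t a\<close> with
      \<open>1 + t k\<close>. As \<open>k * z = y * (star y * z)\<close>, the orbit under
      \<open>1 + t k\<close> is the image under \<open>y\<close> of an orbit under
      \<open>1 + t a\<close> that starts in the range of \<open>q\<close>.\<close>
    have comm: "((\<lambda>w. w + t *\<^sub>R (k * w)) ^^ n) (y * w) = y * (B t ^^ n) w" for w
      by (induction n) (simp_all add: B_def a_def k_def algebra_simps)
    have "norm (((\<lambda>w. w + t *\<^sub>R (k * w)) ^^ n) (k * z)) = norm (y * (B t ^^ n) (star y * z))"
      using comm[of "star y * z"] by (simp add: k_def mult.assoc)
    also have "\<dots> \<le> norm y * ((1 + C * t\<^sup>2) ^ n * norm (star y * z))"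
      using Bn[OF t, of "star y * z" n]
      by (intro order_trans[OF norm_mult_ineq] mult_left_mono) (auto simp: qy simp flip: mult.assoc)
    also have "\<dots> \<le> norm y * ((1 + C * t\<^sup>2) ^ n * (norm y * norm z))"
      using C(1) norm_mult_ineq[of "star y" z] by (intro mult_left_mono) auto
    finally show "norm (((\<lambda>w. w + t *\<^sub>R (k * w)) ^^ n) (k * z))
        \<le> norm y * norm y * (1 + C * t\<^sup>2) ^ n * norm z"
      by (simp add: mult_ac)
  qed simp
  \<comment> \<open>Up to real factors these are the real and imaginary parts of \<open>y\<close>;
    the cross terms of the two squares cancel.\<close>
  define b where "b = y + star y"
  define c where "c = \<i> *\<^sub>C (y - star y)"
  have sbc: "star b = b" "star c = c"
    by (simp_all add: b_def c_def star_add star_diff star_star star_scaleC cvec.scale_right_diff_distrib)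
  have "b * b + c * c = 2 *\<^sub>R (a + k)"
    by (simp add: b_def c_def a_def k_def mult_scaleC_left mult_scaleC_right algebra_simps scaleR_2
        cvec.scale_right_diff_distrib cvec.scale_right_distrib)
  then have ak: "a + k = (1/2) *\<^sub>R (b * b + c * c)" by simp
  have "accretive (a + k)"
    unfolding ak by (intro accretive_scaleR accretive_add accretive_square sbc) simp
  \<comment> \<open>\<open>a\<close> is the sum of \<open>a + k\<close> and \<open>- k\<close>, so
    that both \<open>a\<close> and \<open>- a\<close> are now accretive.\<close>
  from accretive_add[OF this mk] have "accretive a" by simp
  then have "a = 0" using ma sa(1) by (rule accretive_antisym)
  then show ?thesis by (simp add: a_def star_mult_self_eq_0)
qed

section \<open>Orthogonality from the order relation, and square roots\<close>

text \<open>Cutting by \<open>q f\<close> turns \<open>star b * b = p - sum q A\<close> into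
  \<open>star (b * q f) * (b * q f) = - (q f (\<Sum>x\<noteq>f. q x) q f)\<close>, where the sum is
  accretive. Kaplansky's theorem makes both sides vanish. Splitting \<open>q e\<close> off the
  vanishing sum gives an equation of the same shape for \<open>q e * q f\<close>.\<close>

lemma projections_orthogonal_if_sum_le:
  fixes q :: "'i \<Rightarrow> 'a::cstar_algebra"
  assumes A: "finite A" and q: "\<And>e. e \<in> A \<Longrightarrow> projection (q e)"
    and pq: "\<And>e. e \<in> A \<Longrightarrow> p * q e = q e" and le: "cstar_le (sum q A) p"
    and ef: "e \<in> A" "f \<in> A" "e \<noteq> f"
  shows "q e * q f = 0"
proof -
  have qq: "q x * q x = q x" "star (q x) = q x" if "x \<in> A" for x
    using q[OF that] by (simp_all add: projection_def)
  have acc: "accretive (sum q B)" if "B \<subseteq> A" for B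
  proof (rule accretive_sum)
    fix x assume "x \<in> B"
    with that qq[of x] accretive_square[of "q x"] show "accretive (q x)" by auto
  qed
  obtain b where b: "p - sum q A = star b * b"
    using le unfolding cstar_le_def positive_def by blast
  have sum_f: "sum q A = q f + sum q (A - {f})" using A ef(2) by (rule sum.remove)
  have f_absorb: "(p - sum q A) * q f = - (sum q (A - {f}) * q f)"
    by (simp add: sum_f algebra_simps pq qq ef)
  have "star (b * q f) * (b * q f) = q f * ((p - sum q A) * q f)"
    by (simp add: star_mult qq ef b mult.assoc)
  also have "\<dots> = - (q f * sum q (A - {f}) * q f)" by (simp add: f_absorb mult.assoc)
  finally have "b * q f = 0"
    using eq_0_if_star_mult_self_eq_minus_accretive[OF q[OF ef(2)], of "b * q f" "sum q (A - {f})"]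
      acc[of "A - {f}"] by (simp add: mult.assoc qq ef)
  then have "(p - sum q A) * q f = 0" by (simp add: b mult.assoc)
  then have 0: "q f * sum q (A - {f}) * q f = 0" by (simp add: f_absorb mult.assoc)
  have sum_e: "sum q (A - {f}) = q e + sum q (A - {f} - {e})"
    using A ef by (intro sum.remove) auto
  have "star (q e * q f) * (q e * q f) = q f * q e * q f"
    by (simp add: star_mult qq ef mult.assoc) (metis qq(1) ef(1) mult.assoc)
  also have "\<dots> = - (q f * sum q (A - {f} - {e}) * q f)"
    using 0 by (simp add: sum_e algebra_simps eq_neg_iff_add_eq_0)
  finally show ?thesis
    using eq_0_if_star_mult_self_eq_minus_accretive[OF q[OF ef(2)], of "q e * q f" "sum q (A - {f} - {e})"]
      acc[of "A - {f} - {e}"] by (auto simp: mult.assoc qq ef)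
qed

text \<open>The equation says $(1-k)^2 = 1 - h^2$, so that \<open>h + \<i> (1 - k)\<close> is formally unitary.\<close>

lemma ex_one_minus_sqrt:
  fixes h :: "'a::cstar_algebra"
  assumes sa: "star h = h" and h1: "norm h < 1"
  shows "\<exists>k. star k = k \<and> k * h = h * k \<and> 2 *\<^sub>R k - k * k = h * h"
proof -
  define N where "N = norm (h * h)"
  have N: "0 \<le> N" "N < 1"
    using cstar_identity[of h] sa h1 by (simp_all add: N_def abs_square_less_1)
  \<comment> \<open>The smaller root of \<open>N + \<rho>\<^sup>2 = 2 \<rho>\<close>: with this
    radius \<open>F\<close> maps the ball into itself and contracts it with the factor
    \<open>\<rho> < 1\<close>.\<close>
  define \<rho> where "\<rho> = 1 - sqrt (1 - N)"
  have \<rho>: "0 \<le> \<rho>" "\<rho> < 1" using N by (auto simp: \<rho>_def)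
  have "(sqrt (1 - N))\<^sup>2 = 1 - N" using N by simp
  then have N\<rho>: "N + \<rho>\<^sup>2 = 2 * \<rho>" by (simp add: \<rho>_def power2_eq_square algebra_simps)
  \<comment> \<open>Self-adjointness and commutation with \<open>h\<close> are closed conditions
    preserved by \<open>F\<close>; building them into the domain gives them to the fixed
    point.\<close>
  define S where "S = cball 0 \<rho> \<inter> {k. star k = k \<and> k * h = h * k}"
  define F where "F k = (1/2) *\<^sub>R (h * h + k * k)" for k :: 'a
  have "closed S"
    unfolding S_def
    by (intro closed_Int closed_cball closed_Collect_conj closed_Collect_eq continuous_intros)
  then have "complete S" by (simp add: complete_eq_closed)
  moreover have "0 \<in> S" using \<rho> by (simp add: S_def)
  then have "S \<noteq> {}" by blast
  moreover have "F ` S \<subseteq> S"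
  proof (rule image_subsetI)
    fix k assume k: "k \<in> S"
    have "norm (h * h + k * k) \<le> N + \<rho>\<^sup>2"
      using k norm_mult_ineq[of k k] mult_mono[of "norm k" \<rho> "norm k" \<rho>]
      by (intro norm_triangle_le) (auto simp: S_def N_def power2_eq_square intro: order_trans)
    moreover have "star (F k) = F k" "F k * h = h * F k"
      using k sa by (auto simp: S_def F_def star_scaleR star_add star_mult algebra_simps)
        (metis mult.assoc)
    ultimately show "F k \<in> S" using N\<rho> by (simp add: S_def F_def)
  qed
  moreover have "dist (F k) (F l) \<le> \<rho> * dist k l" if "k \<in> S" "l \<in> S" for k l
  proof -
    have "norm (k * k - l * l) = norm (k * (k - l) + (k - l) * l)" by (simp add: algebra_simps)
    also have "\<dots> \<le> norm k * norm (k - l) + norm (k - l) * norm l"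
      by (intro norm_triangle_le add_mono norm_mult_ineq)
    also have "\<dots> \<le> \<rho> * norm (k - l) + norm (k - l) * \<rho>"
      using that by (intro add_mono mult_right_mono mult_left_mono) (auto simp: S_def)
    finally show ?thesis
      by (simp add: F_def dist_norm flip: scaleR_diff_right)
  qed
  ultimately obtain k where k: "k \<in> S" "F k = k"
    using Banach_fix[of S \<rho> F] \<rho> by metis
  have "2 *\<^sub>R k = h * h + k * k"
    by (subst k(2)[symmetric]) (simp add: F_def)
  then show ?thesis using k(1) by (auto simp: S_def algebra_simps)
qed

section \<open>Hilbert modules\<close>

context hilbert_module
begin

lemma ip_add_left: "ip (x + y) z = ip x z + ip y z"
  by (metis ip_add_right ip_star star_add)

lemma ip_scaleC_left: "ip (c *\<^sub>C x) y = cnj c *\<^sub>C ip x y"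
  by (metis ip_scaleC_right ip_star star_scaleC)

lemma ip_scaleR_right: "ip x (r *\<^sub>R y) = r *\<^sub>R ip x y"
  by (simp add: scaleR_scaleC ip_scaleC_right)

lemma ip_scaleR_left: "ip (r *\<^sub>R x) y = r *\<^sub>R ip x y"
  by (simp add: scaleR_scaleC ip_scaleC_left)

lemma ip_ract_left: "ip (ract x a) y = star a * ip x y"
  by (metis ip_ract_right ip_star star_mult)

lemma ip_diff_right: "ip x (y - z) = ip x y - ip x z"
  using ip_add_right[of x "y - z" z] by (simp add: algebra_simps)

lemma ip_diff_left: "ip (x - y) z = ip x z - ip y z"
  using ip_add_left[of "x - y" y z] by (simp add: algebra_simps)

lemma ip_zero_right [simp]: "ip x 0 = 0"
  using ip_diff_right[of x 0 0] by simp

lemma ip_zero_left [simp]: "ip 0 x = 0"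
  using ip_diff_left[of 0 0 x] by simp

lemma ip_sum_right: "ip x (sum f A) = (\<Sum>e\<in>A. ip x (f e))"
  by (induction A rule: infinite_finite_induct) (auto simp: ip_add_right)

lemma norm_ip_self: "norm (ip x x) = (norm x)\<^sup>2"
  by (simp add: norm_ip)

text \<open>Polarization gives a Cauchy-Schwarz inequality with a bad constant but without positivity,
  because the triangle inequality for the norm of the module is already known.\<close>

lemma norm_ip_le: "norm (ip x y) \<le> 4 * norm x * norm y"
proof -
  \<comment> \<open>The four vectors of the polarization formula have norm at most 2, so
    \<open>4 *\<^sub>R ip x y\<close> has norm at most 16.\<close>
  have unit: "norm (ip x y) \<le> 4" if "norm x = 1" "norm y = 1" for x y
  proof -
    have pol: "4 *\<^sub>R ip x y = ip (x + y) (x + y) - ip (x - y) (x - y)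
        + (- \<i>) *\<^sub>C ip (x + \<i> *\<^sub>C y) (x + \<i> *\<^sub>C y) - (- \<i>) *\<^sub>C ip (x - \<i> *\<^sub>C y) (x - \<i> *\<^sub>C y)"
      by (simp add: ip_add_left ip_add_right ip_diff_left ip_diff_right ip_scaleC_left
          ip_scaleC_right cvec.scale_right_distrib cvec.scale_right_diff_distrib algebra_simps)
        (use scaleR_left_distrib[of 2 2 "ip x y"] in \<open>simp add: scaleR_2\<close>)
    have sq: "norm (ip z z) \<le> 4" if "norm z \<le> 2" for z
      using power_mono[OF that, of 2] by (simp add: norm_ip_self)
    have n: "norm (x + y) \<le> 2" "norm (x - y) \<le> 2"
        "norm (x + \<i> *\<^sub>C y) \<le> 2" "norm (x - \<i> *\<^sub>C y) \<le> 2"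
      using that norm_triangle_ineq[of x y] norm_triangle_ineq4[of x y]
        norm_triangle_ineq[of x "\<i> *\<^sub>C y"] norm_triangle_ineq4[of x "\<i> *\<^sub>C y"]
      by (auto simp: norm_scaleC)
    have tri: "norm (a - b + c - d) \<le> norm a + norm b + norm c + norm d" for a b c d :: 'a
      by (smt (verit) norm_triangle_ineq norm_triangle_ineq4)
    have "4 * norm (ip x y) = norm (4 *\<^sub>R ip x y)" by simp
    also have "\<dots> \<le> 4 + 4 + 4 + 4"
      unfolding pol using n[THEN sq] by (intro order_trans[OF tri] add_mono) (auto simp: norm_scaleC)
    finally show ?thesis by simp
  qed
  show ?thesis
  proof (cases "x = 0 \<or> y = 0")
    case False
    have "norm (ip ((1 / norm x) *\<^sub>R x) ((1 / norm y) *\<^sub>R y)) \<le> 4"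
      using False by (intro unit) auto
    then show ?thesis
      using False by (simp add: ip_scaleR_left ip_scaleR_right field_simps)
  qed auto
qed

lemma bounded_linear_ip_right: "bounded_linear (ip x)"
  by (rule bounded_linear_intro[where K = "4 * norm x"])
    (use norm_ip_le[of x] in \<open>auto simp: ip_add_right ip_scaleR_right mult_ac\<close>)

lemma norm_ract_le: "norm (ract x a) \<le> norm x * norm a"
proof -
  have "(norm (ract x a))\<^sup>2 = norm (star a * ip x x * a)"
    by (simp add: norm_ip_self[symmetric] ip_ract_left ip_ract_right mult.assoc)
  also have "\<dots> \<le> norm (star a * ip x x) * norm a" by (rule norm_mult_ineq)
  also have "\<dots> \<le> norm a * (norm x)\<^sup>2 * norm a"
    using norm_mult_ineq[of "star a" "ip x x"] by (intro mult_right_mono) (simp_all add: norm_ip_self)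
  also have "\<dots> = (norm x * norm a)\<^sup>2" by (simp add: power2_eq_square mult_ac)
  finally show ?thesis by (rule power2_le_imp_le) simp
qed

lemma bounded_linear_ract_right: "bounded_linear (ract x)"
  by (rule bounded_linear_intro[where K = "norm x"])
    (use norm_ract_le[of x] in \<open>auto simp: ract_add_right ract_scaleC_right scaleR_scaleC mult.commute\<close>)

lemma eqI_ip:
  assumes "\<And>z. ip z x = ip z y" shows "x = y"
proof -
  have "ip (x - y) (x - y) = 0" by (simp add: ip_diff_right assms)
  then have "norm (x - y) = 0" by (simp add: norm_ip)
  then show ?thesis by simp
qed

lemma is_adjoint_right: "is_adjoint ip S T \<Longrightarrow> ip x (S y) = ip (T x) y"
  by (metis ip_star is_adjoint_def)

lemma adjointable_add: "adjointable ip S \<Longrightarrow> S (x + y) = S x + S y"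
  unfolding adjointable_def by (auto intro!: eqI_ip simp: is_adjoint_right ip_add_right)

text \<open>Serves twice: for the left action on \<open>M\<close> and, with the target taken as a
  Hilbert module over itself, for star homomorphisms. In the constant, one factor 2 comes from
  scaling a self-adjoint element strictly below norm 1, the other from splitting \<open>a\<close>
  into two self-adjoint parts.\<close>

lemma norm_star_action_le:
  fixes \<phi> :: "'c::cstar_algebra \<Rightarrow> 'm \<Rightarrow> 'm"
  assumes add: "\<And>a b x. \<phi> (a + b) x = \<phi> a x + \<phi> b x"
    and scale: "\<And>c a x. \<phi> (c *\<^sub>C a) x = c *\<^sub>C \<phi> a x"
    and mult: "\<And>a b x. \<phi> (a * b) x = \<phi> a (\<phi> b x)"
    and adj: "\<And>a. is_adjoint ip (\<phi> a) (\<phi> (star a))"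
  shows "norm (\<phi> a x) \<le> 4 * norm a * norm x"
proof -
  have ip_l: "ip (\<phi> a x) y = ip x (\<phi> (star a) y)" for a x y
    using adj by (simp add: is_adjoint_def)
  have scaleR: "\<phi> (r *\<^sub>R a) x = r *\<^sub>R \<phi> a x" for r a x by (simp add: scaleR_scaleC scale)
  have lin: "\<phi> a (x - y) = \<phi> a x - \<phi> a y" for a x y
    by (rule eqI_ip) (metis adj ip_diff_right is_adjoint_right)
  have contr: "norm (\<phi> h z) \<le> norm z" if sa: "star h = h" and h1: "norm h < 1" for h z
  proof -
    obtain k where k: "star k = k" "k * h = h * k" "2 *\<^sub>R k - k * k = h * h"
      using ex_one_minus_sqrt[OF sa h1] by blast
    \<comment> \<open>\<open>b\<close> is \<open>(1 - k) z\<close>, so \<open>a + \<i> b\<close> and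
      \<open>a - \<i> b\<close> are the images of \<open>z\<close> under two formal unitaries whose
      average is the action of \<open>h\<close>.\<close>
    define a where "a = \<phi> h z"
    define b where "b = z - \<phi> k z"
    have hh: "\<phi> h (\<phi> h z) = 2 *\<^sub>R \<phi> k z - \<phi> k (\<phi> k z)"
    proof -
      have "\<phi> (h * h + k * k) z = \<phi> (2 *\<^sub>R k) z" by (simp flip: k(3))
      then show ?thesis by (simp add: add mult scaleR algebra_simps)
    qed
    have comm: "\<phi> k (\<phi> h z) = \<phi> h (\<phi> k z)" by (metis mult k(2))
    have ab: "ip a b = ip b a"
      by (simp add: a_def b_def ip_l sa k(1) ip_diff_left ip_diff_right lin comm)
    have sq: "ip a a + ip b b = ip z z"
      by (simp add: a_def b_def ip_l sa k(1) ip_diff_left ip_diff_right ip_scaleR_right lin hh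
          algebra_simps scaleR_2 ip_add_right)
    \<comment> \<open>By \<open>ab\<close> the cross terms combine to the factor
      \<open>c + cnj c\<close>, which vanishes for imaginary \<open>c\<close>.\<close>
    have iso: "norm (a + c *\<^sub>C b) = norm z" if c: "c = \<i> \<or> c = - \<i>" for c
    proof -
      have "ip (a + c *\<^sub>C b) (a + c *\<^sub>C b)
          = ip a a + (cnj c * c) *\<^sub>C ip b b + (c + cnj c) *\<^sub>C ip b a"
        by (simp add: ip_add_left ip_add_right ip_scaleC_left ip_scaleC_right ab algebra_simps
            cvec.scale_right_distrib scaleC_add_left)
      also have "\<dots> = ip z z" using c sq by (auto simp: scaleC_one)
      finally show ?thesis by (simp add: norm_ip)
    qed
    have "2 *\<^sub>R \<phi> h z = (a + \<i> *\<^sub>C b) + (a + (- \<i>) *\<^sub>C b)" by (simp add: a_def scaleR_2)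
    then have "2 * norm (\<phi> h z) \<le> norm (a + \<i> *\<^sub>C b) + norm (a + (- \<i>) *\<^sub>C b)"
      by (metis norm_triangle_ineq norm_scaleR abs_numeral)
    then show ?thesis using iso[OF disjI1[OF refl]] iso[OF disjI2[OF refl]] by linarith
  qed
  have sa_le: "norm (\<phi> h x) \<le> 2 * norm h * norm x" if "star h = h" for h
  proof (cases "h = 0")
    case True
    then show ?thesis using add[of 0 0 x] by simp
  next
    case False
    then have "norm (\<phi> ((1 / (2 * norm h)) *\<^sub>R h) x) \<le> norm x"
      using that by (intro contr) (auto simp: star_scaleR)
    then show ?thesis using False by (simp add: scaleR field_simps)
  qed
  define b where "b = a + star a"
  define c where "c = \<i> *\<^sub>C (a - star a)"
  have sbc: "star b = b" "star c = c"
    by (simp_all add: b_def c_def star_add star_diff star_star star_scaleC cvec.scale_right_diff_distrib)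
  have nbc: "norm b \<le> 2 * norm a" "norm c \<le> 2 * norm a"
    using norm_triangle_ineq[of a "star a"] norm_triangle_ineq4[of a "star a"]
    by (simp_all add: b_def c_def norm_scaleC)
  have "2 *\<^sub>R a = b + (- \<i>) *\<^sub>C c" by (simp add: b_def c_def scaleR_2 scaleC_one)
  then have "2 *\<^sub>R \<phi> a x = \<phi> b x + (- \<i>) *\<^sub>C \<phi> c x" by (metis scaleR add scale)
  then have "2 * norm (\<phi> a x) \<le> norm (\<phi> b x) + norm ((- \<i>) *\<^sub>C \<phi> c x)"
    by (metis norm_triangle_ineq norm_scaleR abs_numeral)
  also have "\<dots> \<le> 2 * norm b * norm x + 2 * norm c * norm x"
    using sa_le[OF sbc(1)] sa_le[OF sbc(2)] by (simp add: norm_scaleC del: cvec.scale_minus_left)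
  also have "\<dots> \<le> 2 * (2 * norm a) * norm x + 2 * (2 * norm a) * norm x"
    using nbc by (intro add_mono mult_right_mono mult_left_mono) auto
  finally show ?thesis by simp
qed

end

section \<open>Star homomorphisms and generated subalgebras\<close>

lemma clinear_iff:
  "clinear f \<longleftrightarrow> (\<forall>x y. f (x + y) = f x + f y) \<and> (\<forall>c x. f (c *\<^sub>C x) = c *\<^sub>C f x)"
  by (auto simp: Vector_Spaces.linear_iff cvec.vector_space_axioms)

lemma clinear_zero: "clinear f \<Longrightarrow> f 0 = 0"
  unfolding clinear_iff by (metis add_cancel_right_right)

lemma clinear_sum: "clinear f \<Longrightarrow> f (sum g A) = (\<Sum>x\<in>A. f (g x))"
  by (induction A rule: infinite_finite_induct) (auto simp: clinear_zero clinear_iff)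

lemma hilbert_module_self: "hilbert_module (\<lambda>x y. star x * y) ((*) :: 'b::cstar_algebra \<Rightarrow> 'b \<Rightarrow> 'b)"
proof
  show "positive (star x * x)" for x :: 'b by (auto simp: positive_def)
  show "norm x = sqrt (norm (star x * x))" for x :: 'b by (simp add: cstar_identity)
qed (simp_all add: algebra_simps mult_scaleC_left mult_scaleC_right star_mult star_star)

lemma star_hom_add: "star_hom f \<Longrightarrow> f (x + y) = f x + f y"
  and star_hom_scaleC: "star_hom f \<Longrightarrow> f (c *\<^sub>C x) = c *\<^sub>C f x"
  and star_hom_mult: "star_hom f \<Longrightarrow> f (x * y) = f x * f y"
  and star_hom_star: "star_hom f \<Longrightarrow> f (star x) = star (f x)"
  by (simp_all add: star_hom_def clinear_iff)

text \<open>Left multiplication by \<open>f a\<close> is a star action on the target. Testing its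
  bound on the vector \<open>star (f a)\<close> yields a bound for \<open>f a\<close> by the
  C*-identity.\<close>

lemma bounded_linear_star_hom:
  fixes f :: "'a::cstar_algebra \<Rightarrow> 'b::cstar_algebra"
  assumes f: "star_hom f" shows "bounded_linear f"
proof -
  interpret hilbert_module "\<lambda>x y. star x * y" "(*) :: 'b \<Rightarrow> 'b \<Rightarrow> 'b" by (rule hilbert_module_self)
  have le: "norm (f a * x) \<le> 4 * norm a * norm x" for a x
    by (rule norm_star_action_le)
      (simp_all add: f star_hom_add star_hom_scaleC star_hom_mult star_hom_star star_mult star_star
        is_adjoint_def distrib_right mult_scaleC_left mult.assoc)
  show ?thesis
  proof (rule bounded_linear_intro[where K = 4])
    show "norm (f a) \<le> norm a * 4" for a
    proof (cases "f a = 0")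
      case False
      have "norm (f a) * norm (f a) = norm (f a * star (f a))"
        using cstar_identity[of "star (f a)"] by (simp add: star_star power2_eq_square)
      also have "\<dots> \<le> 4 * norm a * norm (f a)" using le[of a "star (f a)"] by simp
      finally show ?thesis using False by (simp add: mult.commute)
    qed simp
  qed (simp_all add: f star_hom_add star_hom_scaleC scaleR_scaleC)
qed

lemma continuous_on_star_hom:
  "star_hom f \<Longrightarrow> continuous_on A g \<Longrightarrow> continuous_on A (\<lambda>x. f (g x))"
  by (rule bounded_linear.continuous_on[OF bounded_linear_star_hom])

lemma star_hom_zero: "star_hom f \<Longrightarrow> f 0 = 0"
  using star_hom_add[of f 0 0] by simp

lemma star_hom_sum: "star_hom f \<Longrightarrow> f (sum g A) = (\<Sum>x\<in>A. f (g x))"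
  by (induction A rule: infinite_finite_induct) (auto simp: star_hom_add star_hom_zero)

lemma cstar_generated_UNIV_D:
  "cstar_generated S = UNIV \<Longrightarrow> cstar_subalgebra D \<Longrightarrow> S \<subseteq> D \<Longrightarrow> x \<in> D"
  unfolding cstar_generated_def by blast

lemma cstar_generated_superset: "S \<subseteq> cstar_generated S"
  unfolding cstar_generated_def by blast

lemma cstar_subalgebra_generated: "cstar_subalgebra (cstar_generated S)"
  unfolding cstar_generated_def cstar_subalgebra_def cvec.subspace_def by (auto intro!: closed_Inter)

lemma cstar_subalgebraI:
  assumes "closed D" "0 \<in> D" "\<And>x y. x \<in> D \<Longrightarrow> y \<in> D \<Longrightarrow> x + y \<in> D"
    "\<And>c x. x \<in> D \<Longrightarrow> c *\<^sub>C x \<in> D" "\<And>x y. x \<in> D \<Longrightarrow> y \<in> D \<Longrightarrow> x * y \<in> D"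
    "\<And>x. x \<in> D \<Longrightarrow> star x \<in> D"
  shows "cstar_subalgebra D"
  using assms by (auto simp: cstar_subalgebra_def cvec.subspace_def)

lemma cstar_subalgebra_sum:
  "cstar_subalgebra D \<Longrightarrow> (\<And>x. x \<in> A \<Longrightarrow> f x \<in> D) \<Longrightarrow> sum f A \<in> D"
  unfolding cstar_subalgebra_def by (auto intro: cvec.subspace_sum)

text \<open>Lets \<open>e\<close> be recognized as an identity of the whole algebra from the
  generators alone; used for the sum of the units in C*(G) and for its image under a Toeplitz
  representation.\<close>

lemma cstar_subalgebra_local_identity:
  fixes e :: "'a::cstar_algebra"
  assumes "star e = e" shows "cstar_subalgebra {x. e * x = x \<and> x * e = x}"
proof (rule cstar_subalgebraI)
  show "closed {x. e * x = x \<and> x * e = x}"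
    by (intro closed_Collect_conj closed_Collect_eq continuous_intros)
  show "star x \<in> {x. e * x = x \<and> x * e = x}" if "x \<in> {x. e * x = x \<and> x * e = x}" for x
    using that assms by (metis (mono_tags, lifting) mem_Collect_eq star_mult)
  show "x * y \<in> {x. e * x = x \<and> x * e = x}"
    if "x \<in> {x. e * x = x \<and> x * e = x}" "y \<in> {x. e * x = x \<and> x * e = x}" for x y
    using that by (metis (mono_tags, lifting) mem_Collect_eq mult.assoc)
qed (auto simp: distrib_left distrib_right mult_scaleC_left mult_scaleC_right)

section \<open>Groupoids and self-similar actions\<close>

lemma groupoid_arr_obj: "is_groupoid G \<Longrightarrow> g \<in> garr G \<Longrightarrow> gdom G g \<in> gobj G \<and> gcod G g \<in> gobj G"
  and groupoid_gid: "is_groupoid G \<Longrightarrow> v \<in> gobj G \<Longrightarrow>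
    gid G v \<in> garr G \<and> gdom G (gid G v) = v \<and> gcod G (gid G v) = v"
  and groupoid_comp_gid: "is_groupoid G \<Longrightarrow> g \<in> garr G \<Longrightarrow>
    gcomp G g (gid G (gdom G g)) = g \<and> gcomp G (gid G (gcod G g)) g = g"
  and groupoid_inverse: "is_groupoid G \<Longrightarrow> g \<in> garr G \<Longrightarrow>
    \<exists>h\<in>garr G. gdom G h = gcod G g \<and> gcod G h = gdom G g \<and>
      gcomp G h g = gid G (gdom G g) \<and> gcomp G g h = gid G (gcod G g)"
  by (auto simp: is_groupoid_def)

lemma unitary_rep_mult: "unitary_rep G U \<Longrightarrow> g \<in> garr G \<Longrightarrow> h \<in> garr G \<Longrightarrow>
    U g * U h = (if gdom G g = gcod G h then U (gcomp G g h) else 0)"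
  and unitary_rep_projection: "unitary_rep G U \<Longrightarrow> v \<in> gobj G \<Longrightarrow> projection (U (gid G v))"
  by (simp_all add: unitary_rep_def)

text \<open>\<open>h\<close> is the inverse of \<open>g\<close>. The generators of C*(G) thus form a
  star-closed set, which matters where a condition not symmetric under \<open>star\<close> is
  extended from them.\<close>

lemma unitary_rep_star:
  assumes G: "is_groupoid G" and U: "unitary_rep G U" and g: "g \<in> garr G"
  shows "\<exists>h\<in>garr G. star (U g) = U h"
proof -
  obtain h where h: "h \<in> garr G" "gdom G h = gcod G g" "gcod G h = gdom G g"
      "gcomp G h g = gid G (gdom G g)" "gcomp G g h = gid G (gcod G g)"
    using groupoid_inverse[OF G g] by blast
  have pi: "U g * star (U g) * U g = U g" and ini: "star (U g) * U g = U (gid G (gdom G g))"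
    and fin: "U g * star (U g) = U (gid G (gcod G g))"
    using U g by (auto simp: unitary_rep_def partial_isometry_def)
  have "star (U g) = star (U g) * (U g * star (U g))"
    using arg_cong[OF pi, of star] by (simp add: star_mult star_star mult.assoc)
  also have "\<dots> = star (U g) * (U g * U h)"
    using unitary_rep_mult[OF U g h(1)] h by (simp add: fin)
  also have "\<dots> = U (gcomp G h g) * U h" by (simp add: ini h flip: mult.assoc)
  also have "\<dots> = U h"
    using groupoid_gid[OF G, of "gdom G g"] groupoid_arr_obj[OF G g] groupoid_comp_gid[OF G h(1)] h
    by (simp add: unitary_rep_mult[OF U])
  finally show ?thesis using h(1) by blast
qed

lemma unitary_rep_star_hom:
  assumes G: "is_groupoid G" and U: "unitary_rep G U" and \<pi>: "star_hom \<pi>"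
    and V: "\<And>g. g \<in> garr G \<Longrightarrow> V g = \<pi> (U g)"
  shows "unitary_rep G V"
proof -
  note hom = star_hom_mult[OF \<pi>, symmetric] star_hom_star[OF \<pi>, symmetric]
  have gid: "V (gid G v) = \<pi> (U (gid G v))" if "v \<in> gobj G" for v
    using groupoid_gid[OF G that] V by simp
  have iso: "U g * star (U g) * U g = U g" "star (U g) * U g = U (gid G (gdom G g))"
      "U g * star (U g) = U (gid G (gcod G g))" if "g \<in> garr G" for g
    using U that by (auto simp: unitary_rep_def partial_isometry_def)
  show ?thesis
    unfolding unitary_rep_def
  proof (intro conjI ballI)
    show "projection (V (gid G v))" if "v \<in> gobj G" for v
      using unitary_rep_projection[OF U that] that by (simp add: projection_def gid hom)
    show "partial_isometry (V g)" "star (V g) * V g = V (gid G (gdom G g))"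
      "V g * star (V g) = V (gid G (gcod G g))" if "g \<in> garr G" for g
      using iso[OF that] groupoid_arr_obj[OF G that] that
      by (simp_all add: partial_isometry_def gid V hom)
    show "V g * V h = (if gdom G g = gcod G h then V (gcomp G g h) else 0)"
      if "g \<in> garr G" "h \<in> garr G" for g h
    proof -
      have "V g * V h = \<pi> (U g * U h)" using that by (simp add: V hom)
      moreover have "gcomp G g h \<in> garr G" if "gdom G g = gcod G h"
        using G \<open>g \<in> garr G\<close> \<open>h \<in> garr G\<close> that by (simp add: is_groupoid_def)
      ultimately show ?thesis
        using that by (simp add: unitary_rep_mult[OF U] V star_hom_zero[OF \<pi>])
    qed
  qed
qed

lemma paths_len_0: "paths_len E v 0 = (if v \<in> verts E then {(v, [])} else {})"
  by (auto simp: paths_len_def)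

lemma paths_len_1: "paths_len E v (Suc 0) =
    {(v, [e]) | e. e \<in> arcs E \<and> head E e = v \<and> tail E e \<in> verts E}"
  by (auto simp: paths_len_def length_Suc_conv)

lemma fst_in_paths: "\<mu> \<in> paths E v \<Longrightarrow> fst \<mu> = v"
  by (auto simp: paths_def paths_len_def)

locale self_similar = wf_digraph E for E :: "('v, 'e) pre_digraph" +
  fixes G :: "('v, 'g) groupoid" and \<Phi> :: "('v, 'e, 'g) action"
  assumes action: "self_similar_action E G \<Phi>"
begin

lemma groupoid: "is_groupoid G" and objs: "gobj G = verts E"
  using action by (simp_all add: self_similar_action_def)

lemma partial_iso_act:
  assumes "g \<in> garr G" shows "partial_iso E (gdom G g) (gcod G g) (act \<Phi> g)"
    and "\<Phi> g = (gdom G g, gcod G g, act \<Phi> g)"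
proof -
  obtain v w f where vwf: "\<Phi> g = (v, w, f)" by (cases "\<Phi> g")
  have "\<Phi> g \<in> garr (PIso E)" "gdom (PIso E) (\<Phi> g) = gdom G g" "gcod (PIso E) (\<Phi> g) = gcod G g"
    using action assms by (auto simp: self_similar_action_def unit_preserving_hom_def)
  then have "partial_iso E v w f" "v = gdom G g" "w = gcod G g"
    by (auto simp: PIso_def vwf)
  moreover have "act \<Phi> g = f" by (simp add: fun_eq_iff act_def vwf)
  ultimately show "partial_iso E (gdom G g) (gcod G g) (act \<Phi> g)"
    "\<Phi> g = (gdom G g, gcod G g, act \<Phi> g)" using vwf by simp_all
qed

lemma act_paths:
  assumes "g \<in> garr G" "\<mu> \<in> paths E (gdom G g)" shows "act \<Phi> g \<mu> \<in> paths E (gcod G g)"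
  using partial_iso_act(1)[OF assms(1)] assms(2) by (auto simp: partial_iso_def bij_betw_def)

lemma act_gid:
  assumes "v \<in> verts E" "\<mu> \<in> paths E v" shows "act \<Phi> (gid G v) \<mu> = \<mu>"
proof -
  have "\<Phi> (gid G v) = gid (PIso E) v"
    using action assms(1) by (simp add: self_similar_action_def unit_preserving_hom_def)
  then show ?thesis using assms(2) by (simp add: act_def PIso_def)
qed

lemma act_vertex_eq:
  assumes "g \<in> garr G" shows "act_vertex \<Phi> g (gdom G g) = gcod G g"
proof -
  have "gdom G g \<in> verts E" "gcod G g \<in> verts E"
    using groupoid_arr_obj[OF groupoid assms] by (simp_all add: objs)
  then have "act \<Phi> g (gdom G g, []) \<in> {(gcod G g, [])}"
    using partial_iso_act(1)[OF assms] unfolding partial_iso_def bij_betw_def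
    by (metis (no_types) paths_len_0 imageI insertI1)
  then show ?thesis by (simp add: act_vertex_def)
qed

lemma edge_path_in_paths: "e \<in> arcs E \<Longrightarrow> edge_path E e \<in> paths_len E (head E e) (Suc 0)"
  by (auto simp: paths_len_1 edge_path_def)

lemma act_edge:
  assumes "g \<in> garr G" "e \<in> arcs E" "gdom G g = head E e"
  shows "act_edge E \<Phi> g e \<in> arcs E" and "head E (act_edge E \<Phi> g e) = gcod G g"
    and "act \<Phi> g (edge_path E e) = edge_path E (act_edge E \<Phi> g e)"
proof -
  have "act \<Phi> g (edge_path E e) \<in> paths_len E (gcod G g) (Suc 0)"
    using partial_iso_act(1)[OF assms(1)] edge_path_in_paths[OF assms(2)] assms(3)
    unfolding partial_iso_def bij_betw_def by (metis imageI)
  then obtain f where "act \<Phi> g (edge_path E e) = (gcod G g, [f])" "f \<in> arcs E" "head E f = gcod G g"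
    by (auto simp: paths_len_1)
  then show "act_edge E \<Phi> g e \<in> arcs E" "head E (act_edge E \<Phi> g e) = gcod G g"
    "act \<Phi> g (edge_path E e) = edge_path E (act_edge E \<Phi> g e)"
    by (simp_all add: act_edge_def edge_path_def)
qed

lemma restriction_unique:
  assumes "is_restriction E G \<Phi> g e h" "is_restriction E G \<Phi> g e k" shows "h = k"
proof -
  have h: "h \<in> garr G" "gdom G h = tail E e" "gcod G h = tail E (act_edge E \<Phi> g e)"
    and k: "k \<in> garr G" "gdom G k = tail E e" "gcod G k = tail E (act_edge E \<Phi> g e)"
    using assms by (simp_all add: is_restriction_def)
  have "act \<Phi> h \<mu> = act \<Phi> k \<mu>" if \<mu>: "\<mu> \<in> paths E (tail E e)" for \<mu>
  proof (rule prod_eqI)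
    \<comment> \<open>\<open>path_concat\<close> discards the range of its second argument, so
      cancelling the common prefix compares only edge lists. The ranges agree because
      \<open>h\<close> and \<open>k\<close> have the same codomain.\<close>
    show "fst (act \<Phi> h \<mu>) = fst (act \<Phi> k \<mu>)"
      using act_paths[OF h(1), of \<mu>] act_paths[OF k(1), of \<mu>] \<mu> h k by (simp add: fst_in_paths)
    have "path_concat (act \<Phi> g (edge_path E e)) (act \<Phi> h \<mu>)
        = path_concat (act \<Phi> g (edge_path E e)) (act \<Phi> k \<mu>)"
      using assms \<mu> by (metis is_restriction_def)
    then show "snd (act \<Phi> h \<mu>) = snd (act \<Phi> k \<mu>)" by (simp add: path_concat_def)
  qed
  moreover have "act \<Phi> h \<in> extensional (paths E (tail E e))" "act \<Phi> k \<in> extensional (paths E (tail E e))"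
    using partial_iso_act(1)[OF h(1)] partial_iso_act(1)[OF k(1)] h k by (simp_all add: partial_iso_def)
  ultimately have "act \<Phi> h = act \<Phi> k" by (metis extensionalityI)
  then have "\<Phi> h = \<Phi> k" using partial_iso_act(2)[OF h(1)] partial_iso_act(2)[OF k(1)] h k by simp
  then show ?thesis using action h(1) k(1) by (auto simp: self_similar_action_def inj_on_def)
qed

lemma restriction_eqI: "is_restriction E G \<Phi> g e h \<Longrightarrow> restriction E G \<Phi> g e = h"
  unfolding restriction_def by (blast intro: the_equality restriction_unique)

lemma restriction:
  assumes "g \<in> garr G" "e \<in> arcs E" "gdom G g = head E e"
  shows "restriction E G \<Phi> g e \<in> garr G" and "gdom G (restriction E G \<Phi> g e) = tail E e"
    and "gcod G (restriction E G \<Phi> g e) = tail E (act_edge E \<Phi> g e)"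
proof -
  obtain h where h: "is_restriction E G \<Phi> g e h"
    using action assms unfolding self_similar_action_def by blast
  then show "restriction E G \<Phi> g e \<in> garr G" "gdom G (restriction E G \<Phi> g e) = tail E e"
    "gcod G (restriction E G \<Phi> g e) = tail E (act_edge E \<Phi> g e)"
    using restriction_eqI[OF h] by (simp_all add: is_restriction_def)
qed

lemma act_edge_gid:
  assumes "e \<in> arcs E" shows "act_edge E \<Phi> (gid G (head E e)) e = e"
  using assms edge_path_in_paths[OF assms]
  by (subst act_edge_def, subst act_gid) (auto simp: edge_path_def paths_def)

text \<open>Together with \<open>act_edge_gid\<close> this makes relation (3) at a unit read
  \<open>p (head E e) * s e = s e * p (tail E e)\<close>, the origin of
  \<open>p (head E e) * s e = s e\<close>, which \<open>toeplitz_ck_family\<close> does not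
  list.\<close>

lemma restriction_gid:
  assumes e: "e \<in> arcs E" shows "restriction E G \<Phi> (gid G (head E e)) e = gid G (tail E e)"
proof (rule restriction_eqI)
  have "path_concat (edge_path E e) \<mu> \<in> paths E (head E e)" if "\<mu> \<in> paths E (tail E e)" for \<mu>
    using that e by (auto simp: paths_def paths_len_def path_concat_def edge_path_def)
  moreover have "edge_path E e \<in> paths E (head E e)"
    using edge_path_in_paths[OF e] by (auto simp: paths_def)
  ultimately show "is_restriction E G \<Phi> (gid G (head E e)) e (gid G (tail E e))"
    using e groupoid_gid[OF groupoid, of "tail E e"]
    by (simp add: is_restriction_def objs act_edge_gid act_gid)
qed

end

section \<open>The module of a self-similar action\<close>

locale self_similar_module = fin_digraph E + self_similar E G \<Phi> + graph_tensor_module E G i ip ract tens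
  for E :: "('v, 'e) pre_digraph" and G :: "('v, 'g) groupoid" and \<Phi> :: "('v, 'e, 'g) action"
    and i :: "'g \<Rightarrow> 'a::cstar_algebra" and ip :: "'m::cbanach \<Rightarrow> 'm \<Rightarrow> 'a"
    and ract :: "'m \<Rightarrow> 'a \<Rightarrow> 'm" and tens :: "('e \<Rightarrow> complex) \<Rightarrow> 'a \<Rightarrow> 'm" +
  fixes \<phi> :: "'a \<Rightarrow> 'm \<Rightarrow> 'm"
  assumes rep: "unitary_rep G i"
    and generated: "cstar_generated (i ` garr G) = UNIV"
    and bimodule: "bimodule_action E G \<Phi> i ip tens \<phi>"
begin

definition one :: 'a where "one = groupoid_one G i"

text \<open>A frame rather than a basis: the inner product of \<open>basis e\<close> with itself is
  the projection at the source of \<open>e\<close>, so a coefficient counts only after left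
  multiplication by that projection.\<close>

definition basis :: "'e \<Rightarrow> 'm" where "basis e = tens (point_mass e) one"

lemma gid_arr: "v \<in> verts E \<Longrightarrow> gid G v \<in> garr G"
  and gdom_gid: "v \<in> verts E \<Longrightarrow> gdom G (gid G v) = v"
  and gcod_gid: "v \<in> verts E \<Longrightarrow> gcod G (gid G v) = v"
  using groupoid_gid[OF groupoid] by (simp_all add: objs)

lemma arr_verts: "g \<in> garr G \<Longrightarrow> gdom G g \<in> verts E" "g \<in> garr G \<Longrightarrow> gcod G g \<in> verts E"
  using groupoid_arr_obj[OF groupoid] by (simp_all add: objs)

lemma one_eq: "one = (\<Sum>v\<in>verts E. i (gid G v))"
  by (simp add: one_def groupoid_one_def objs)

lemma star_i_gid: "v \<in> verts E \<Longrightarrow> star (i (gid G v)) = i (gid G v)"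
  using unitary_rep_projection[OF rep] by (simp add: objs projection_def)

lemma gid_mult: "g \<in> garr G \<Longrightarrow> v \<in> verts E \<Longrightarrow> unitary_rep G U \<Longrightarrow>
    U (gid G v) * U g = (if v = gcod G g then U g else 0)"
  by (auto simp: unitary_rep_mult gid_arr gdom_gid groupoid_comp_gid[OF groupoid])

lemma mult_gid: "g \<in> garr G \<Longrightarrow> v \<in> verts E \<Longrightarrow> unitary_rep G U \<Longrightarrow>
    U g * U (gid G v) = (if gdom G g = v then U g else 0)"
  by (auto simp: unitary_rep_mult gid_arr gcod_gid groupoid_comp_gid[OF groupoid])

lemma star_one: "star one = one"
  by (simp add: one_eq star_sum star_i_gid)

lemma one_mult [simp]: "one * a = a" and mult_one [simp]: "a * one = a"
proof -
  have "i g \<in> {a. one * a = a \<and> a * one = a}" if "g \<in> garr G" for g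
    using that arr_verts[OF that] by (simp add: one_eq sum_distrib_left sum_distrib_right gid_mult mult_gid rep)
  then have "a \<in> {a. one * a = a \<and> a * one = a}" for a
    by (intro cstar_generated_UNIV_D[OF generated cstar_subalgebra_local_identity[OF star_one]]) auto
  then show "one * a = a" "a * one = a" by auto
qed

lemma point_mass_in_edge_functions [simp]: "e \<in> arcs E \<Longrightarrow> point_mass e \<in> edge_functions E"
  by (auto simp: edge_functions_def point_mass_def)

lemma vertex_embedding_if: "v \<in> verts E \<Longrightarrow>
    vertex_embedding G i (\<lambda>w. if w = v then c else 0) = c *\<^sub>C i (gid G v)"
  by (simp add: vertex_embedding_def objs if_distrib[of "\<lambda>c. c *\<^sub>C _"] cong: if_cong)

lemma graph_ip_point_mass:
  assumes "e \<in> arcs E" "f \<in> arcs E"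
  shows "graph_ip E (point_mass e) (point_mass f) = (\<lambda>v. if v = tail E e then of_bool (e = f) else 0)"
proof
  fix v
  have "(\<Sum>x\<in>{x \<in> arcs E. tail E x = v}. cnj (point_mass e x) * point_mass f x)
      = (\<Sum>x\<in>{x \<in> arcs E. tail E x = v}. if x = e then of_bool (e = f) else 0)"
    by (intro sum.cong) (auto simp: point_mass_def)
  then show "graph_ip E (point_mass e) (point_mass f) v = (if v = tail E e then of_bool (e = f) else 0)"
    using assms by (auto simp: graph_ip_def)
qed

lemma ract_basis: "e \<in> arcs E \<Longrightarrow> ract (basis e) a = tens (point_mass e) a"
  by (simp add: basis_def tens_ract)

lemma ip_basis: "e \<in> arcs E \<Longrightarrow> f \<in> arcs E \<Longrightarrow>
    ip (basis e) (basis f) = (if e = f then i (gid G (tail E e)) else 0)"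
  by (simp add: basis_def tens_ip graph_ip_point_mass vertex_embedding_if star_one scaleC_one)

lemma ract_basis_source:
  assumes e: "e \<in> arcs E" shows "ract (basis e) (i (gid G (tail E e)) * a) = ract (basis e) a"
proof -
  have "graph_ract E (point_mass e) (point_mass (tail E e)) = point_mass e"
    by (auto simp: graph_ract_def point_mass_def)
  moreover have "point_mass (tail E e) \<in> vertex_functions E"
    using e by (auto simp: vertex_functions_def point_mass_def)
  moreover have "vertex_embedding G i (point_mass (tail E e)) = i (gid G (tail E e))"
    using vertex_embedding_if[of "tail E e" 1] e by (simp add: point_mass_def scaleC_one)
  ultimately show ?thesis
    using tens_balanced[of "point_mass e" "point_mass (tail E e)" a] e by (simp add: ract_basis)
qed

lemma ract_one [simp]: "ract m one = m"
  by (rule eqI_ip) (simp add: ip_ract_right)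

lemma source_mult_ip_basis: "e \<in> arcs E \<Longrightarrow> i (gid G (tail E e)) * ip (basis e) m = ip (basis e) m"
  by (metis (no_types) ip_ract_left mult_one ract_basis_source ract_one star_i_gid tail_in_verts)

lemma tens_expand:
  assumes x: "x \<in> edge_functions E" shows "tens x a = (\<Sum>e\<in>arcs E. x e *\<^sub>C ract (basis e) a)"
proof -
  have sub: "tens (\<lambda>f. \<Sum>e\<in>A. x e * point_mass e f) a = (\<Sum>e\<in>A. x e *\<^sub>C ract (basis e) a)
      \<and> (\<lambda>f. \<Sum>e\<in>A. x e * point_mass e f) \<in> edge_functions E"
    if "finite A" "A \<subseteq> arcs E" for A
    using that
  proof (induction A)
    case empty
    have "(\<lambda>_. 0) \<in> edge_functions E" by (simp add: edge_functions_def)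
    then show ?case using tens_scaleC_left[of "\<lambda>_. 0" 0 a] by simp
  next
    case (insert e A)
    then have "(\<lambda>f. x e * point_mass e f) \<in> edge_functions E"
      by (auto simp: edge_functions_def point_mass_def)
    with insert show ?case
      using tens_add_left[of "\<lambda>f. x e * point_mass e f" "\<lambda>f. \<Sum>e\<in>A. x e * point_mass e f" a]
      by (auto simp: tens_scaleC_left ract_basis) (auto simp: edge_functions_def)
  qed
  have "(\<lambda>f. \<Sum>e\<in>arcs E. x e * point_mass e f) = x"
  proof
    fix f
    have "(\<Sum>e\<in>arcs E. x e * point_mass e f) = (\<Sum>e\<in>arcs E. if e = f then x f else 0)"
      by (intro sum.cong) (auto simp: point_mass_def)
    then show "(\<Sum>e\<in>arcs E. x e * point_mass e f) = x f"
      using x by (auto simp: edge_functions_def)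
  qed
  with sub[of "arcs E"] show ?thesis by simp
qed

lemma ip_basis_expansion:
  assumes "f \<in> arcs E" "\<And>e. e \<in> arcs E \<Longrightarrow> i (gid G (tail E e)) * c e = c e"
  shows "ip (basis f) (\<Sum>e\<in>arcs E. ract (basis e) (c e)) = c f"
proof -
  have "ip (basis f) (\<Sum>e\<in>arcs E. ract (basis e) (c e)) = (\<Sum>e\<in>arcs E. if f = e then c e else 0)"
    unfolding ip_sum_right using assms by (intro sum.cong) (auto simp: ip_ract_right ip_basis)
  then show ?thesis using assms by simp
qed

text \<open>The right-hand side is a bounded linear function of \<open>m\<close>, so the vectors
  that it fixes form a closed subspace, and elementary tensors suffice.\<close>

lemma basis_expansion: "m = (\<Sum>e\<in>arcs E. ract (basis e) (ip (basis e) m))"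
proof -
  define R where "R m = (\<Sum>e\<in>arcs E. ract (basis e) (ip (basis e) m))" for m
  have "bounded_linear R"
    unfolding R_def
    by (intro bounded_linear_sum bounded_linear_compose[OF bounded_linear_ract_right] bounded_linear_ip_right)
  then have "continuous_on UNIV R" by (rule linear_continuous_on)
  then have cl: "closed {m. R m = m}" by (intro closed_Collect_eq continuous_intros)
  have "R 0 = 0" using \<open>bounded_linear R\<close> by (simp add: bounded_linear.linear linear_0)
  moreover have "R (x + y) = R x + R y" "R (c *\<^sub>C x) = c *\<^sub>C R x" for c x y
    by (simp_all add: R_def ip_add_right ip_scaleC_right ract_add_right ract_scaleC_right sum.distrib
        cvec.scale_sum_right)
  ultimately have "csubspace {m. R m = m}" by (simp add: cvec.subspace_def)
  moreover have "{tens x a | x a. x \<in> edge_functions E} \<subseteq> {m. R m = m}"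
  proof clarify
    fix x a assume x: "x \<in> edge_functions E"
    \<comment> \<open>Inserting the source projection leaves the module element unchanged and makes
      each coefficient invariant under it, as \<open>ip_basis_expansion\<close> requires.\<close>
    have 1: "tens x a = (\<Sum>e\<in>arcs E. ract (basis e) (x e *\<^sub>C (i (gid G (tail E e)) * a)))"
      by (simp add: tens_expand[OF x] ract_scaleC_right ract_basis_source)
    have "i (gid G (tail E e)) * (x e *\<^sub>C (i (gid G (tail E e)) * a)) = x e *\<^sub>C (i (gid G (tail E e)) * a)"
      if "e \<in> arcs E" for e
      using that by (simp add: mult_scaleC_right gid_mult rep gid_arr gcod_gid flip: mult.assoc)
    then have "ip (basis f) (tens x a) = x f *\<^sub>C (i (gid G (tail E f)) * a)" if "f \<in> arcs E" for f
      unfolding 1 using that by (intro ip_basis_expansion)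
    then show "R (tens x a) = tens x a" by (simp add: R_def 1)
  qed
  ultimately have "cspan {tens x a | x a. x \<in> edge_functions E} \<subseteq> {m. R m = m}"
    by (intro cvec.span_minimal)
  then have "closure (cspan {tens x a | x a. x \<in> edge_functions E}) \<subseteq> {m. R m = m}"
    using cl by (rule closure_minimal)
  then have "R m = m" using tens_dense by auto
  then show ?thesis by (simp add: R_def)
qed

lemma action_add: "\<phi> (a + b) x = \<phi> a x + \<phi> b x"
  and action_scaleC: "\<phi> (c *\<^sub>C a) x = c *\<^sub>C \<phi> a x"
  and action_mult: "\<phi> (a * b) x = \<phi> a (\<phi> b x)"
  and action_adjointable: "adjointable ip (\<phi> a)"
  and action_adjoint: "is_adjoint ip (\<phi> a) (\<phi> (star a))"
  using bimodule by (simp_all add: bimodule_action_def left_action_def)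

lemma action_zero: "\<phi> 0 x = 0"
  using action_add[of 0 0 x] by simp

lemma action_sum_left: "\<phi> (sum f A) x = (\<Sum>y\<in>A. \<phi> (f y) x)"
  by (induction A rule: infinite_finite_induct) (auto simp: action_zero action_add)

lemma action_zero_right: "\<phi> a 0 = 0"
  using adjointable_add[OF action_adjointable, of a 0 0] by simp

lemma action_sum_right: "\<phi> a (sum f A) = (\<Sum>y\<in>A. \<phi> a (f y))"
  by (induction A rule: infinite_finite_induct)
    (auto simp: action_zero_right adjointable_add[OF action_adjointable])

lemma bounded_linear_action: "bounded_linear (\<lambda>a. \<phi> a x)"
proof (rule bounded_linear_intro[where K = "4 * norm x"])
  show "norm (\<phi> a x) \<le> norm a * (4 * norm x)" for a
    using norm_star_action_le[of \<phi> a x] by (simp add: action_add action_scaleC action_mult action_adjoint mult_ac)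
qed (simp_all add: action_add action_scaleC scaleR_scaleC)

lemma action_arr_basis:
  assumes "g \<in> garr G" "e \<in> arcs E"
  shows "\<phi> (i g) (ract (basis e) a) = (if gdom G g = head E e
    then ract (basis (act_edge E \<Phi> g e)) (i (restriction E G \<Phi> g e) * a) else 0)"
proof -
  obtain W where "module_rep E G \<Phi> i ip tens W" "\<And>g. g \<in> garr G \<Longrightarrow> \<phi> (i g) = W g"
    using bimodule unfolding bimodule_action_def by blast
  then show ?thesis using assms by (simp add: module_rep_def ract_basis act_edge(1))
qed

lemma action_one [simp]: "\<phi> one m = m"
proof -
  have "\<phi> one (ract (basis e) a) = ract (basis e) a" if e: "e \<in> arcs E" for e a
  proof -
    have "\<phi> one (ract (basis e) a) = (\<Sum>v\<in>verts E. if v = head E e then ract (basis e) a else 0)"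
      unfolding one_eq action_sum_left
      using e by (intro sum.cong)
        (auto simp: action_arr_basis gid_arr gdom_gid act_edge_gid restriction_gid ract_basis_source)
    then show ?thesis using e by simp
  qed
  then show ?thesis
    by (subst (1 2) basis_expansion[of m]) (simp add: action_sum_right)
qed

section \<open>Toeplitz representations and self-similar families\<close>

text \<open>\<open>toeplitz_rep\<close> contains only the two-sided identity. Taking the unit on
  both sides gives \<open>\<psi> m = \<pi> one * \<psi> m * \<pi> one\<close>, so the idempotent
  \<open>\<pi> one\<close> acts as an identity on the range of \<open>\<psi>\<close>, although the
  target may have none, and the one-sided rules follow.\<close>

lemma
  assumes T: "toeplitz_rep ip ract \<phi> \<psi> \<pi>"
  shows toeplitz_rep_left: "\<psi> (\<phi> a m) = \<pi> a * \<psi> m"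
    and toeplitz_rep_right: "\<psi> (ract m b) = \<psi> m * \<pi> b"
    and toeplitz_rep_one: "\<pi> one * \<psi> m = \<psi> m" "\<psi> m * \<pi> one = \<psi> m"
proof -
  have bi: "\<psi> (ract (\<phi> a m) b) = \<pi> a * \<psi> m * \<pi> b" for a m b
    using T by (simp add: toeplitz_rep_def)
  have hom: "\<pi> one * \<pi> one = \<pi> one"
    using T star_hom_mult[of \<pi> one one] by (simp add: toeplitz_rep_def)
  have *: "\<psi> m = \<pi> one * \<psi> m * \<pi> one" for m using bi[of one m one] by simp
  show l: "\<pi> one * \<psi> m = \<psi> m" for m by (subst (1 2) *) (simp add: hom flip: mult.assoc)
  show r: "\<psi> m * \<pi> one = \<psi> m" for m by (subst (1 2) *) (simp add: hom mult.assoc)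
  show "\<psi> (\<phi> a m) = \<pi> a * \<psi> m" using bi[of a m one] by (simp add: r mult.assoc)
  show "\<psi> (ract m b) = \<psi> m * \<pi> b" using bi[of one m b] by (simp add: l)
qed

text \<open>All relations but the order relation are identities computed from the action on
  \<open>basis e\<close>. For that one, the sum \<open>Q\<close> of the orthogonal range projections
  is a projection below \<open>p v\<close>; hence \<open>p v - Q\<close> is a projection and equals
  its own star-square.\<close>

lemma self_similar_family_of_toeplitz_rep:
  assumes T: "toeplitz_rep ip ract \<phi> \<psi> \<pi>"
    and u: "\<And>g. g \<in> garr G \<Longrightarrow> u g = \<pi> (i g)"
    and p: "\<And>v. v \<in> verts E \<Longrightarrow> p v = \<pi> (i (gid G v))"
    and s: "\<And>e. e \<in> arcs E \<Longrightarrow> s e = \<psi> (basis e)"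
  shows "self_similar_family E G \<Phi> u p s"
proof -
  have \<pi>: "star_hom \<pi>" and \<psi>_ip: "\<And>m n. star (\<psi> m) * \<psi> n = \<pi> (ip m n)"
    and \<psi>0: "\<psi> 0 = 0"
    using T by (auto simp: toeplitz_rep_def clinear_zero)
  have U: "unitary_rep G u" by (rule unitary_rep_star_hom[OF groupoid rep \<pi> u])
  have up: "u (gid G v) = p v" if "v \<in> verts E" for v using that by (simp add: u p gid_arr)
  have us: "u g * s e = (if gdom G g = head E e then s (act_edge E \<Phi> g e) * u (restriction E G \<Phi> g e) else 0)"
    if "g \<in> garr G" "e \<in> arcs E" for g e
    using that action_arr_basis[OF that, of one] toeplitz_rep_left[OF T, of "i g" "basis e"]
    by (auto simp: u s act_edge(1) restriction(1) toeplitz_rep_right[OF T] \<psi>0)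
  have upv: "u g * p v = (if gdom G g = v then p (act_vertex \<Phi> g v) * u g else 0)"
    if "g \<in> garr G" "v \<in> verts E" for g v
    using that mult_gid[OF that U] gid_mult[OF that(1) arr_verts(2)[OF that(1)] U]
    by (auto simp: act_vertex_eq arr_verts simp flip: up)
  have pp: "p v * p v = p v" "star (p v) = p v" if "v \<in> verts E" for v
    using unitary_rep_projection[OF U, of v] that by (simp_all add: up objs projection_def)
  have ss: "star (s e) * s f = (if e = f then p (tail E e) else 0)" if "e \<in> arcs E" "f \<in> arcs E" for e f
    using that by (simp add: s \<psi>_ip ip_basis p star_hom_zero[OF \<pi>])
  have sp: "s e * p (tail E e) = s e" if "e \<in> arcs E" for e
    using that ract_basis_source[of e one] by (simp add: s p flip: toeplitz_rep_right[OF T])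
  have ps: "p (head E e) * s e = s e" if "e \<in> arcs E" for e
    using us[of "gid G (head E e)" e] that by (simp add: up gid_arr gdom_gid act_edge_gid restriction_gid sp)
  have le: "cstar_le (\<Sum>e\<in>{e\<in>arcs E. head E e = v}. s e * star (s e)) (p v)" if v: "v \<in> verts E" for v
  proof -
    define Q where "Q = (\<Sum>e\<in>{e\<in>arcs E. head E e = v}. s e * star (s e))"
    have sQ: "star Q = Q" by (simp add: Q_def star_sum star_mult star_star)
    have pQ: "p v * Q = Q"
      unfolding Q_def sum_distrib_left by (intro sum.cong) (auto simp: ps simp flip: mult.assoc)
    then have Qp: "Q * p v = Q" using pp[OF v] sQ by (metis star_mult)
    have "Q * s e = s e" if "e \<in> arcs E" "head E e = v" for e
    proof -
      have "Q * s e = (\<Sum>f\<in>{e\<in>arcs E. head E e = v}. if f = e then s e else 0)"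
        unfolding Q_def sum_distrib_right using that
        by (intro sum.cong) (auto simp: mult.assoc ss sp)
      then show ?thesis using that by simp
    qed
    then have "(\<Sum>e\<in>{e\<in>arcs E. head E e = v}. Q * s e * star (s e)) = Q"
      unfolding Q_def[symmetric] by (subst (2) Q_def) (intro sum.cong, auto)
    then have "Q * Q = Q"
      by (subst (2) Q_def) (simp add: sum_distrib_left mult.assoc)
    then have "p v - Q = star (p v - Q) * (p v - Q)"
      by (simp add: star_diff pp[OF v] sQ pQ Qp algebra_simps)
    then show ?thesis unfolding cstar_le_def positive_def Q_def by blast
  qed
  have "toeplitz_ck_family E p s"
    unfolding toeplitz_ck_family_def projection_def partial_isometry_def
  proof (intro conjI ballI impI)
    show "p v * p w = 0" if "v \<in> verts E" "w \<in> verts E" "v \<noteq> w" for v w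
      using gid_mult[OF gid_arr[OF that(2)] that(1) U] that by (simp add: up gcod_gid)
    show "s e * star (s e) * s e = s e" if "e \<in> arcs E" for e
      using that by (simp add: mult.assoc ss sp)
  qed (auto simp: pp ss le)
  then show ?thesis
    unfolding self_similar_family_def using U up us upv by blast
qed

text \<open>An induction principle for the generated algebra: the preimage of \<open>D\<close> under
  \<open>\<pi>\<close> is closed because \<open>\<pi>\<close> is bounded, so it is all of C*(G), and
  the finite expansion of \<open>m\<close> then places \<open>\<psi> m\<close> in
  \<open>D\<close>.\<close>

lemma toeplitz_rep_generated:
  assumes T: "toeplitz_rep ip ract \<phi> \<psi> \<pi>"
    and gen: "cstar_generated (range \<psi> \<union> range \<pi>) = UNIV"
    and D: "cstar_subalgebra D"
    and u: "\<And>g. g \<in> garr G \<Longrightarrow> \<pi> (i g) \<in> D" and s: "\<And>e. e \<in> arcs E \<Longrightarrow> \<psi> (basis e) \<in> D"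
  shows "x \<in> D"
proof (rule cstar_generated_UNIV_D[OF gen D])
  have \<pi>: "star_hom \<pi>" and \<psi>: "clinear \<psi>" using T by (auto simp: toeplitz_rep_def)
  have "closed D" using D by (simp add: cstar_subalgebra_def)
  then have "closed (\<pi> -` D)"
    by (intro closed_vimage continuous_on_star_hom[OF \<pi>] continuous_on_id)
  then have "cstar_subalgebra (\<pi> -` D)"
    using D by (intro cstar_subalgebraI)
      (auto simp: cstar_subalgebra_def cvec.subspace_def star_hom_zero[OF \<pi>] star_hom_add[OF \<pi>]
        star_hom_scaleC[OF \<pi>] star_hom_mult[OF \<pi>] star_hom_star[OF \<pi>])
  then have \<pi>D: "\<pi> a \<in> D" for a
    using cstar_generated_UNIV_D[OF generated, of "\<pi> -` D" a] u by auto

  have "\<psi> m \<in> D" for m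
  proof -
    have "\<psi> m = (\<Sum>e\<in>arcs E. \<psi> (basis e) * \<pi> (ip (basis e) m))"
      by (subst basis_expansion) (simp add: clinear_sum[OF \<psi>] toeplitz_rep_right[OF T])
    also have "\<dots> \<in> D"
      using D s \<pi>D by (intro cstar_subalgebra_sum) (auto simp: cstar_subalgebra_def)
    finally show ?thesis .
  qed
  then show "range \<psi> \<union> range \<pi> \<subseteq> D" using \<pi>D by auto
qed

lemma toeplitz_rep_identity:
  assumes T: "toeplitz_rep ip ract \<phi> \<psi> \<pi>"
    and gen: "cstar_generated (range \<psi> \<union> range \<pi>) = UNIV"
  shows "\<pi> one * x = x \<and> x * \<pi> one = x"
proof -
  let ?D = "{x. \<pi> one * x = x \<and> x * \<pi> one = x}"
  have \<pi>: "star_hom \<pi>" using T by (auto simp: toeplitz_rep_def)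
  have so: "star (\<pi> one) = \<pi> one" by (simp add: star_hom_star[OF \<pi>, symmetric] star_one)
  have "x \<in> ?D"
    by (rule toeplitz_rep_generated[OF T gen cstar_subalgebra_local_identity[OF so]])
      (auto simp: toeplitz_rep_one[OF T] star_hom_mult[OF \<pi>, symmetric])
  then show ?thesis by blast
qed

lemma toeplitz_rep_of_self_similar_family:
  fixes U :: "'g \<Rightarrow> 'b::cstar_algebra"
  assumes fam: "self_similar_family E G \<Phi> U P S"
    and \<pi>: "star_hom \<pi>" and \<pi>U: "\<And>g. g \<in> garr G \<Longrightarrow> \<pi> (i g) = U g"
  shows "\<exists>\<psi>. toeplitz_rep ip ract \<phi> \<psi> \<pi> \<and> (\<forall>e\<in>arcs E. \<psi> (basis e) = S e)"
proof -
  have U: "unitary_rep G U" and UP: "\<And>v. v \<in> verts E \<Longrightarrow> U (gid G v) = P v"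
    and ck: "toeplitz_ck_family E P S"
    and US: "\<And>g e. g \<in> garr G \<Longrightarrow> e \<in> arcs E \<Longrightarrow> U g * S e =
        (if gdom G g = head E e then S (act_edge E \<Phi> g e) * U (restriction E G \<Phi> g e) else 0)"
    using fam by (auto simp: self_similar_family_def)
  have SS: "star (S e) * S e = P (tail E e)" and SSS: "S e * star (S e) * S e = S e" if "e \<in> arcs E" for e
    using ck that by (auto simp: toeplitz_ck_family_def partial_isometry_def)
  have SP: "S e * P (tail E e) = S e" if "e \<in> arcs E" for e
    using SS[OF that] SSS[OF that] by (metis mult.assoc)
  have PS: "P (head E e) * S e = S e" if "e \<in> arcs E" for e
    using US[of "gid G (head E e)" e] that by (simp add: UP gid_arr gdom_gid act_edge_gid restriction_gid SP)
  have star_P: "star (P v) = P v" and PP: "v \<noteq> w \<Longrightarrow> P v * P w = 0" if "v \<in> verts E" "w \<in> verts E" for v w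
    using ck that by (auto simp: toeplitz_ck_family_def projection_def)
  \<comment> \<open>For equal ranges this comes from the order relation; for different ranges the
    vertex projections are already orthogonal.\<close>
  have orth: "star (S e) * S f = 0" if ef: "e \<in> arcs E" "f \<in> arcs E" "e \<noteq> f" for e f
  proof (cases "head E e = head E f")
    case True
    let ?A = "{x\<in>arcs E. head E x = head E e}"
    have "(S e * star (S e)) * (S f * star (S f)) = 0"
    proof (rule projections_orthogonal_if_sum_le[where A = ?A and p = "P (head E e)" and q = "\<lambda>x. S x * star (S x)"])
      show "projection (S x * star (S x))" if "x \<in> ?A" for x
        using that SSS[of x] by (simp add: projection_def star_mult star_star flip: mult.assoc)
      show "P (head E e) * (S x * star (S x)) = S x * star (S x)" if "x \<in> ?A" for x
        using that PS[of x] by (auto simp flip: mult.assoc)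
      show "cstar_le (\<Sum>x\<in>?A. S x * star (S x)) (P (head E e))"
        using ck ef(1) by (auto simp: toeplitz_ck_family_def)
    qed (use ef True in auto)
    then have 0: "star (S e) * (S e * star (S e) * (S f * star (S f))) * S f = 0" by simp
    \<comment> \<open>The partial isometry relations insert the range projections of
      \<open>S e\<close> and \<open>S f\<close> next to each other, where their product is
      0.\<close>
    have "star (S e) * S f = (star (S e) * (S e * star (S e))) * (S f * star (S f) * S f)"
      using SSS[OF ef(2)] arg_cong[OF SSS[OF ef(1)], of star] by (simp add: star_mult star_star mult.assoc)
    also have "\<dots> = 0" using 0 by (simp add: mult.assoc)
    finally show ?thesis .
  next
    case False
    have "star (S e) * S f = star (P (head E e) * S e) * (P (head E f) * S f)"
      using PS ef by simp
    also have "\<dots> = star (S e) * (P (head E e) * P (head E f)) * S f"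
      using ef star_P[of "head E e" "head E e"] by (simp add: star_mult mult.assoc)
    finally show ?thesis using PP[of "head E e" "head E f"] False ef by simp
  qed
  note hom = star_hom_add[OF \<pi>] star_hom_scaleC[OF \<pi>] star_hom_mult[OF \<pi>] star_hom_star[OF \<pi>]
  define \<psi> where "\<psi> m = (\<Sum>e\<in>arcs E. S e * \<pi> (ip (basis e) m))" for m
  have \<psi>_add: "\<psi> (x + y) = \<psi> x + \<psi> y" for x y
    by (simp add: \<psi>_def ip_add_right hom distrib_left sum.distrib)
  have \<psi>_scaleC: "\<psi> (c *\<^sub>C x) = c *\<^sub>C \<psi> x" for c x
    by (simp add: \<psi>_def ip_scaleC_right hom mult_scaleC_right cvec.scale_sum_right)
  have \<psi>_right: "\<psi> (ract m b) = \<psi> m * \<pi> b" for m b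
    by (simp add: \<psi>_def ip_ract_right hom sum_distrib_right mult.assoc)
  have \<psi>_0: "\<psi> 0 = 0" using \<psi>_add[of 0 0] by simp
  have \<psi>_sum: "\<psi> (sum f A) = (\<Sum>e\<in>A. \<psi> (f e))" for f :: "'e \<Rightarrow> 'm" and A
    by (induction A rule: infinite_finite_induct) (auto simp: \<psi>_0 \<psi>_add)
  have \<pi>P: "\<pi> (i (gid G v)) = P v" if "v \<in> verts E" for v
    using that by (simp add: \<pi>U UP gid_arr)
  have \<psi>_basis: "\<psi> (basis e) = S e" if "e \<in> arcs E" for e
  proof -
    have "\<psi> (basis e) = (\<Sum>f\<in>arcs E. if f = e then S e else 0)"
      unfolding \<psi>_def using that
      by (intro sum.cong) (auto simp: ip_basis \<pi>P SP star_hom_zero[OF \<pi>])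
    then show ?thesis using that by simp
  qed
  \<comment> \<open>Orthogonality leaves the diagonal terms. There \<open>P (tail E e)\<close> is
    the image of the source projection, which the coefficient absorbs, and the expansion of
    \<open>n\<close> inside \<open>ip m\<close> remains.\<close>
  have \<psi>_ip: "star (\<psi> m) * \<psi> n = \<pi> (ip m n)" for m n
  proof -
    have "star (\<psi> m) * \<psi> n = (\<Sum>e\<in>arcs E. \<Sum>f\<in>arcs E.
        star (\<pi> (ip (basis e) m)) * (star (S e) * S f) * \<pi> (ip (basis f) n))"
      by (simp add: \<psi>_def star_sum star_mult sum_product mult.assoc)
    also have "\<dots> = (\<Sum>e\<in>arcs E. \<Sum>f\<in>arcs E.
        if e = f then star (\<pi> (ip (basis e) m)) * P (tail E e) * \<pi> (ip (basis e) n) else 0)"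
      by (intro sum.cong) (auto simp: SS orth)
    also have "\<dots> = (\<Sum>e\<in>arcs E. \<pi> (ip m (basis e) * (i (gid G (tail E e)) * ip (basis e) n)))"
      by (simp add: hom(3) \<pi>P ip_star mult.assoc flip: star_hom_star[OF \<pi>])
    also have "\<dots> = (\<Sum>e\<in>arcs E. \<pi> (ip m (ract (basis e) (ip (basis e) n))))"
      by (simp add: source_mult_ip_basis ip_ract_right)
    also have "\<dots> = \<pi> (ip m n)"
      by (subst (2) basis_expansion[of n]) (simp add: ip_sum_right star_hom_sum[OF \<pi>])
    finally show ?thesis .
  qed
  have \<psi>_arr: "\<psi> (\<phi> (i g) m) = \<pi> (i g) * \<psi> m" if g: "g \<in> garr G" for g m
  proof -
    have "\<psi> (\<phi> (i g) (ract (basis e) a)) = \<pi> (i g) * \<psi> (ract (basis e) a)" if e: "e \<in> arcs E" for e a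
      using US[OF g e] g e
      by (simp add: action_arr_basis \<psi>_right \<psi>_basis act_edge(1) restriction(1) hom \<psi>_0
          \<pi>U flip: mult.assoc)
    then show ?thesis
      by (subst (1 2) basis_expansion[of m]) (simp add: action_sum_right \<psi>_sum sum_distrib_left)
  qed
  have \<psi>_left: "\<psi> (\<phi> a m) = \<pi> a * \<psi> m" for a m
  proof -
    let ?P = "\<lambda>a. \<forall>m. \<psi> (\<phi> a m) = \<pi> a * \<psi> m"
    \<comment> \<open>The condition \<open>?P\<close> is not visibly stable under
      \<open>star\<close>, so it is imposed on \<open>star a\<close> too. Closedness is where
      boundedness of \<open>\<pi>\<close> and of the left action enters.\<close>
    let ?D = "{a. ?P a \<and> ?P (star a)}"
    have "closed ?D"
      unfolding \<psi>_def
      by (intro closed_Collect_conj closed_Collect_all closed_Collect_eq continuous_intros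
          continuous_on_star_hom[OF \<pi>] bounded_linear.continuous_on[OF bounded_linear_ip_right]
          bounded_linear.continuous_on[OF bounded_linear_action])
    then have "cstar_subalgebra ?D"
      by (rule cstar_subalgebraI)
        (auto simp: action_zero action_add action_scaleC action_mult star_hom_zero[OF \<pi>] hom \<psi>_0
          \<psi>_add \<psi>_scaleC star_add star_scaleC star_mult star_star distrib_right mult_scaleC_left mult.assoc)
    moreover have "i ` garr G \<subseteq> ?D"
    proof clarify
      fix g assume g: "g \<in> garr G"
      obtain h where "h \<in> garr G" "star (i g) = i h"
        using unitary_rep_star[OF groupoid rep g] by blast
      then show "?P (i g) \<and> ?P (star (i g))" using \<psi>_arr g by simp
    qed
    ultimately have "a \<in> ?D" by (rule cstar_generated_UNIV_D[OF generated])
    then show ?thesis by blast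
  qed
  have "toeplitz_rep ip ract \<phi> \<psi> \<pi>"
    unfolding toeplitz_rep_def
    using \<pi> by (auto simp: clinear_iff \<psi>_add \<psi>_scaleC \<psi>_right \<psi>_left \<psi>_ip)
  then show ?thesis using \<psi>_basis by blast
qed

end

theorem proposition4p4:
  fixes E :: "('v, 'e) pre_digraph"
    and G :: "('v, 'g) groupoid"
    and \<Phi> :: "('v, 'e, 'g) action"
    and i :: "'g \<Rightarrow> 'a::cstar_algebra"
    and ip :: "'m::cbanach \<Rightarrow> 'm \<Rightarrow> 'a"
    and ract :: "'m \<Rightarrow> 'a \<Rightarrow> 'm"
    and tens :: "('e \<Rightarrow> complex) \<Rightarrow> 'a \<Rightarrow> 'm"
    and \<phi> :: "'a \<Rightarrow> 'm \<Rightarrow> 'm"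
    and iM :: "'m \<Rightarrow> 't::cstar_algebra"
    and iA :: "'a \<Rightarrow> 't"
    and u :: "'g \<Rightarrow> 't" and p :: "'v \<Rightarrow> 't" and s :: "'e \<Rightarrow> 't"
  assumes "fin_digraph E" and "without_sources E"
    and "self_similar_action E G \<Phi>"
    and "universal_unitary_rep TYPE('b::cstar_algebra) G i"
    and "graph_tensor_module E G i ip ract tens"
    and "bimodule_action E G \<Phi> i ip tens \<phi>"
    and "universal_toeplitz_rep TYPE('b) ip ract \<phi> iM iA"
    and "\<And>g. g \<in> garr G \<Longrightarrow> u g = iA (i g)"
    and "\<And>v. v \<in> verts E \<Longrightarrow> p v = iA (i (gid G v))"
    and "\<And>e. e \<in> arcs E \<Longrightarrow> s e = iM (tens (point_mass e) (groupoid_one G i))"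
  shows "self_similar_family E G \<Phi> u p s \<and>
    (\<forall>x. (\<Sum>v\<in>verts E. p v) * x = x \<and> x * (\<Sum>v\<in>verts E. p v) = x) \<and>
    cstar_generated (u ` garr G \<union> p ` verts E \<union> s ` arcs E) = UNIV \<and>
    (\<forall>(U :: 'g \<Rightarrow> 'b) P S. self_similar_family E G \<Phi> U P S \<longrightarrow>
           (\<exists>\<rho> :: 't \<Rightarrow> 'b. star_hom \<rho> \<and> (\<forall>g\<in>garr G. \<rho> (u g) = U g) \<and>
              (\<forall>v\<in>verts E. \<rho> (p v) = P v) \<and> (\<forall>e\<in>arcs E. \<rho> (s e) = S e)))"
proof -
  have rep: "unitary_rep G i" and gen: "cstar_generated (i ` garr G) = UNIV"
    and univ: "\<And>U :: 'g \<Rightarrow> 'b. unitary_rep G U \<Longrightarrow>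
      \<exists>\<pi> :: 'a \<Rightarrow> 'b. star_hom \<pi> \<and> (\<forall>g\<in>garr G. \<pi> (i g) = U g)"
    using assms(4) by (auto simp: universal_unitary_rep_def)
  have T: "toeplitz_rep ip ract \<phi> iM iA" and genT: "cstar_generated (range iM \<union> range iA) = UNIV"
    and univT: "\<And>(\<psi> :: 'm \<Rightarrow> 'b) \<pi>. toeplitz_rep ip ract \<phi> \<psi> \<pi> \<Longrightarrow>
      \<exists>\<rho> :: 't \<Rightarrow> 'b. star_hom \<rho> \<and> (\<forall>m. \<rho> (iM m) = \<psi> m) \<and> (\<forall>a. \<rho> (iA a) = \<pi> a)"
    using assms(7) unfolding universal_toeplitz_rep_def by blast+
  interpret fin_digraph E by fact
  interpret graph_tensor_module E G i ip ract tens by fact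
  interpret self_similar_module E G \<Phi> i ip ract tens \<phi>
    by unfold_locales (use assms(3,6) rep gen in auto)
  have iA: "star_hom iA" using T by (simp add: toeplitz_rep_def)
  have s: "s e = iM (basis e)" if "e \<in> arcs E" for e
    using that assms(10) by (simp add: basis_def one_def)
  have "iA one = (\<Sum>v\<in>verts E. p v)" using assms(9) by (simp add: one_eq star_hom_sum[OF iA])
  then have id: "(\<Sum>v\<in>verts E. p v) * x = x \<and> x * (\<Sum>v\<in>verts E. p v) = x" for x
    using toeplitz_rep_identity[OF T genT, of x] by simp
  let ?gen = "u ` garr G \<union> p ` verts E \<union> s ` arcs E"
  have "x \<in> cstar_generated ?gen" for x
  proof (rule toeplitz_rep_generated[OF T genT cstar_subalgebra_generated])
    show "iA (i g) \<in> cstar_generated ?gen" if "g \<in> garr G" for g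
      using that assms(8)[OF that] cstar_generated_superset[of ?gen] by auto
    show "iM (basis e) \<in> cstar_generated ?gen" if "e \<in> arcs E" for e
      using that s[OF that] cstar_generated_superset[of ?gen] by auto
  qed
  then have "cstar_generated ?gen = UNIV" by blast
  moreover have "\<exists>\<rho> :: 't \<Rightarrow> 'b. star_hom \<rho> \<and> (\<forall>g\<in>garr G. \<rho> (u g) = U g) \<and>
      (\<forall>v\<in>verts E. \<rho> (p v) = P v) \<and> (\<forall>e\<in>arcs E. \<rho> (s e) = S e)"
    if fam: "self_similar_family E G \<Phi> U P S" for U :: "'g \<Rightarrow> 'b" and P S
  proof -
    have "unitary_rep G U" and UP: "\<forall>v\<in>verts E. U (gid G v) = P v"
      using fam by (simp_all add: self_similar_family_def)
    then obtain \<pi> :: "'a \<Rightarrow> 'b" where \<pi>: "star_hom \<pi>" "\<And>g. g \<in> garr G \<Longrightarrow> \<pi> (i g) = U g"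
      using univ by blast
    obtain \<psi> where \<psi>: "toeplitz_rep ip ract \<phi> \<psi> \<pi>" "\<forall>e\<in>arcs E. \<psi> (basis e) = S e"
      using toeplitz_rep_of_self_similar_family[OF fam \<pi>] by blast
    obtain \<rho> :: "'t \<Rightarrow> 'b" where "star_hom \<rho>" "\<forall>m. \<rho> (iM m) = \<psi> m" "\<forall>a. \<rho> (iA a) = \<pi> a"
      using univT[OF \<psi>(1)] by blast
    then show ?thesis
      using \<pi>(2) \<psi>(2) UP by (intro exI[of _ \<rho>]) (simp add: assms(8,9) s gid_arr)
  qed
  ultimately show ?thesis
    using self_similar_family_of_toeplitz_rep[OF T assms(8,9) s] id by blast
qed

end
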